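(* For each $q\ge 0$, the assignment $X\mapsto H_q^{c_1}(X)$ on objects, sending a continuous function $f:X\to Y$ to the homomorphism $f_*^{c_1}:H_q^{c_1}(X)\to H_q^{c_1}(Y)$ induced by $f_\#^{c_1}$, is a functor (to abelian groups) on the category of $c_1$-digital images and $(c_1,c_1)$-continuous functions.
   Context: Two points of $\mathbb{Z}^n$ are $c_1$-adjacent if they differ by exactly $1$ in one coordinate and agree in all others. A $c_1$-digital image is a subset $X\subseteq\mathbb{Z}^n$ (for some $n$) with this adjacency. A function between $c_1$-digital images is $(c_1,c_1)$-continuous (continuous) if adjacent points map to equal or adjacent points. Let $I=\{0,1\}$, $I^q\subset\mathbb{Z}^q$ with $c_1$-adjacency. A singular $q$-cube in $X$ is a continuous map $\sigma:I^q\to X$. $c_1$-complex of $X\subseteq\mathbb{Z}^n$: an elementary interval is $\{a\}$ (degenerate) or $\{a,a+1\}$ (nondegenerate), $a\in\mathbb{Z}$. An elementary $q$-cube is $Q=J_1\times\cdots\times J_n$ with $J_i$ elementary intervals, exactly $q$ of them nondegenerate. $C_q^{c_1}(X)$ is the free abelian group on the elementary $q$-cubes $Q\subseteq X$. $A_i^{c_1}Q$ (resp. $B_i^{c_1}Q$) is obtained by replacing $J_i$ with $\{\min J_i\}$ (resp. $\{\max J_i\}$). If $k_1<\dots<k_q$ are the indices with $J_{k_i}$ nondegenerate, $\partial_q^{c_1}Q=\sum_{i=1}^q(-1)^i(A_{k_i}^{c_1}Q-B_{k_i}^{c_1}Q)$. $H_q^{c_1}(X)$ is the homology of this chain complex.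 Orientation: let $\Sigma_q$ be the symmetric group; $\pi\in\Sigma_q$ acts on $I^q$ by $\pi(t_1,\dots,t_q)=(t_{\pi(1)},\dots,t_{\pi(q)})$; $\oplus$ is coordinatewise addition mod 2. An embedding matrix is an $n\times q$ matrix obtained by inserting $n-q$ zero rows into the $q\times q$ identity matrix. Every injective singular $q$-cube $\sigma$ in $X\subseteq\mathbb{Z}^n$ is uniquely of the form $\sigma(t)=M(z\oplus\pi(t))+x$ with $M$ an embedding matrix, $z\in\mathbb{Z}_2^q$, $\pi\in\Sigma_q$, $x\in X$; moreover its image $\sigma(I^q)$ is an elementary $q$-cube. Its orientation is $o^\sigma=(-1)^{\#z}(-1)^\pi$, where $\#z$ is the number of nonzero coordinates of $z$ and $(-1)^\pi$ is the sign of $\pi$. For a singular $q$-cube $\sigma$ set $\beta_q(\sigma)=0$ if $\sigma$ is noninjective, and $\beta_q(\sigma)=o^\sigma\cdot\sigma(I^q)\in C_q^{c_1}$ if $\sigma$ is injective. Induced map: for an elementary $q$-cube $Q\subseteq X\subseteq\mathbb{Z}^n$ let $\sigma_Q:I^q\to Q$ be $\sigma_Q(t)=Mt+x$, where $x$ is the lexicographically minimal element of $Q$ and $M$ is the $n\times q$ matrix with columns the standard basis vectors $e_{k_1},\dots,e_{k_q}$, $k_1<\dots<k_q$ being the coordinates in which $Q$ is nondegenerate. For continuous $f:X\to Y$, the homomorphism $f_\#^{c_1}:C_q^{c_1}(X)\to C_q^{c_1}(Y)$ is defined on generators by $f_\#^{c_1}(Q)=\beta_q(f\circ\sigma_Q)$.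 These homomorphisms form a chain map. *)

theory Defs
  imports
    "HOL-Algebra.Free_Abelian_Groups"
    "HOL-Combinatorics.Permutations"
    "Jordan_Normal_Form.Matrix"
begin

section \<open>Categories and functors\<close>

text \<open>Hom-sets are indexed by their source and target, so arrows with different
  sources or targets need not be different elements of the type of arrows.
  \<open>Cmp C X Y Z g f\<close> is the composite of \<open>f\<close> from \<open>X\<close> to \<open>Y\<close>
  followed by \<open>g\<close> from \<open>Y\<close> to \<open>Z\<close>.\<close>

record ('o, 'm) category =
  Ob :: "'o set"
  Arr :: "'o \<Rightarrow> 'o \<Rightarrow> 'm set"
  Idt :: "'o \<Rightarrow> 'm"
  Cmp :: "'o \<Rightarrow> 'o \<Rightarrow> 'o \<Rightarrow> 'm \<Rightarrow> 'm \<Rightarrow> 'm"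

definition is_category :: "('o, 'm) category \<Rightarrow> bool" where
  "is_category C \<longleftrightarrow>
     (\<forall>X \<in> Ob C. Idt C X \<in> Arr C X X) \<and>
     (\<forall>X \<in> Ob C. \<forall>Y \<in> Ob C. \<forall>Z \<in> Ob C. \<forall>f \<in> Arr C X Y. \<forall>g \<in> Arr C Y Z.
        Cmp C X Y Z g f \<in> Arr C X Z) \<and>
     (\<forall>X \<in> Ob C. \<forall>Y \<in> Ob C. \<forall>f \<in> Arr C X Y.
        Cmp C X Y Y (Idt C Y) f = f \<and> Cmp C X X Y f (Idt C X) = f) \<and>
     (\<forall>W \<in> Ob C. \<forall>X \<in> Ob C. \<forall>Y \<in> Ob C. \<forall>Z \<in> Ob C.
        \<forall>f \<in> Arr C W X. \<forall>g \<in> Arr C X Y. \<forall>h \<in> Arr C Y Z.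
        Cmp C W X Z (Cmp C X Y Z h g) f = Cmp C W Y Z h (Cmp C W X Y g f))"

definition is_functor ::
  "('o, 'm) category \<Rightarrow> ('p, 'n) category \<Rightarrow> ('o \<Rightarrow> 'p) \<Rightarrow> ('o \<Rightarrow> 'o \<Rightarrow> 'm \<Rightarrow> 'n) \<Rightarrow> bool" where
  "is_functor C D F\<^sub>O F\<^sub>A \<longleftrightarrow>
     is_category C \<and> is_category D \<and>
     (\<forall>X \<in> Ob C. F\<^sub>O X \<in> Ob D) \<and>
     (\<forall>X \<in> Ob C. \<forall>Y \<in> Ob C. \<forall>f \<in> Arr C X Y. F\<^sub>A X Y f \<in> Arr D (F\<^sub>O X) (F\<^sub>O Y)) \<and>
     (\<forall>X \<in> Ob C. F\<^sub>A X X (Idt C X) = Idt D (F\<^sub>O X)) \<and>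
     (\<forall>X \<in> Ob C. \<forall>Y \<in> Ob C. \<forall>Z \<in> Ob C. \<forall>f \<in> Arr C X Y. \<forall>g \<in> Arr C Y Z.
        F\<^sub>A X Z (Cmp C X Y Z g f) =
          Cmp D (F\<^sub>O X) (F\<^sub>O Y) (F\<^sub>O Z) (F\<^sub>A Y Z g) (F\<^sub>A X Y f))"

text \<open>Homomorphisms are restricted to the carrier, so that equality of arrows is
  equality as maps between carriers.\<close>

definition abelian_group_category :: "('a monoid, 'a \<Rightarrow> 'a) category" where
  "abelian_group_category =
     \<lparr>Ob = {G. comm_group G},
      Arr = (\<lambda>G H. hom G H \<inter> extensional (carrier G)),
      Idt = (\<lambda>G. \<lambda>a \<in> carrier G. a),
      Cmp = (\<lambda>G H K. compose (carrier G))\<rparr>"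


section \<open>Digital images\<close>

text \<open>The lattice \<open>\<int>\<^sup>n\<close> is \<^term>\<open>carrier_vec n :: int vec set\<close>.
  Coordinates are numbered from \<open>0\<close>.\<close>

definition c1_adjacent :: "int vec \<Rightarrow> int vec \<Rightarrow> bool" where
  "c1_adjacent x y \<longleftrightarrow>
     dim_vec x = dim_vec y \<and>
     (\<exists>i < dim_vec x. \<bar>x $ i - y $ i\<bar> = 1 \<and> (\<forall>j < dim_vec x. j \<noteq> i \<longrightarrow> x $ j = y $ j))"

definition digital_image :: "int vec set \<Rightarrow> bool" where
  "digital_image X \<longleftrightarrow> (\<exists>n. X \<subseteq> carrier_vec n)"

definition c1_continuous :: "int vec set \<Rightarrow> int vec set \<Rightarrow> (int vec \<Rightarrow> int vec) \<Rightarrow> bool" where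
  "c1_continuous X Y f \<longleftrightarrow>
     f \<in> X \<rightarrow> Y \<and>
     (\<forall>x \<in> X. \<forall>y \<in> X. c1_adjacent x y \<longrightarrow> f x = f y \<or> c1_adjacent (f x) (f y))"

definition digital_image_category :: "(int vec set, int vec \<Rightarrow> int vec) category" where
  "digital_image_category =
     \<lparr>Ob = {X. digital_image X},
      Arr = (\<lambda>X Y. {f. c1_continuous X Y f} \<inter> extensional X),
      Idt = (\<lambda>X. \<lambda>x \<in> X. x),
      Cmp = (\<lambda>X Y Z. compose X)\<rparr>"


section \<open>The \<open>c\<^sub>1\<close>-cubical chain complex and its homology\<close>

definition elementary_interval :: "int set \<Rightarrow> bool" where
  "elementary_interval J \<longleftrightarrow> (\<exists>a. J = {a} \<or> J = {a, a + 1})"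

definition nondegenerate :: "int set \<Rightarrow> bool" where
  "nondegenerate J \<longleftrightarrow> (\<exists>a. J = {a, a + 1})"

definition box :: "int set list \<Rightarrow> int vec set" where
  "box Js = {x \<in> carrier_vec (length Js). \<forall>i < length Js. x $ i \<in> Js ! i}"

text \<open>The indices \<open>k\<^sub>1 < \<dots> < k\<^sub>q\<close> of the nondegenerate factors, in increasing order.\<close>

definition nondeg_indices :: "int set list \<Rightarrow> nat list" where
  "nondeg_indices Js = filter (\<lambda>i. nondegenerate (Js ! i)) [0..<length Js]"

definition elementary_cube :: "nat \<Rightarrow> int vec set \<Rightarrow> bool" where
  "elementary_cube q Q \<longleftrightarrow>
     (\<exists>Js. (\<forall>J \<in> set Js. elementary_interval J) \<and> length (nondeg_indices Js) = q \<and> Q = box Js)"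

text \<open>Elementary intervals are nonempty, so an elementary cube determines its list of factors.\<close>

definition factors :: "int vec set \<Rightarrow> int set list" where
  "factors Q = (THE Js. (\<forall>J \<in> set Js. elementary_interval J) \<and> Q = box Js)"

definition face_A :: "nat \<Rightarrow> int vec set \<Rightarrow> int vec set" where
  "face_A i Q = box ((factors Q)[i := {Min (factors Q ! i)}])"

definition face_B :: "nat \<Rightarrow> int vec set \<Rightarrow> int vec set" where
  "face_B i Q = box ((factors Q)[i := {Max (factors Q ! i)}])"

definition chain_group :: "nat \<Rightarrow> int vec set \<Rightarrow> (int vec set \<Rightarrow>\<^sub>0 int) monoid" where
  "chain_group q X = free_Abelian_group {Q. elementary_cube q Q \<and> Q \<subseteq> X}"

text \<open>One map serves as \<open>\<partial>\<^sub>q\<close> for every \<open>q\<close>, since a cube determines its number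
  of nondegenerate factors; on \<open>0\<close>-cubes the sum is empty. List positions start at \<open>0\<close>,
  hence \<open>ks ! (i - 1)\<close> is \<open>k\<^sub>i\<close>.\<close>

definition boundary :: "(int vec set \<Rightarrow>\<^sub>0 int) \<Rightarrow> (int vec set \<Rightarrow>\<^sub>0 int)" where
  "boundary = frag_extend (\<lambda>Q. let ks = nondeg_indices (factors Q) in
     \<Sum>i = 1..length ks. frag_cmul ((- 1) ^ i)
       (frag_of (face_A (ks ! (i - 1)) Q) - frag_of (face_B (ks ! (i - 1)) Q)))"

definition cycles :: "nat \<Rightarrow> int vec set \<Rightarrow> (int vec set \<Rightarrow>\<^sub>0 int) set" where
  "cycles q X = {c \<in> carrier (chain_group q X). boundary c = 0}"

definition boundaries :: "nat \<Rightarrow> int vec set \<Rightarrow> (int vec set \<Rightarrow>\<^sub>0 int) set" where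
  "boundaries q X = boundary ` carrier (chain_group (Suc q) X)"

definition homology :: "nat \<Rightarrow> int vec set \<Rightarrow> (int vec set \<Rightarrow>\<^sub>0 int) set monoid" where
  "homology q X = (chain_group q X)\<lparr>carrier := cycles q X\<rparr> Mod boundaries q X"


section \<open>Orientation of injective singular cubes\<close>

definition unit_cube :: "nat \<Rightarrow> int vec set" where
  "unit_cube q = {t \<in> carrier_vec q. \<forall>i < q. t $ i \<in> {0, 1}}"

definition perm_vec :: "(nat \<Rightarrow> nat) \<Rightarrow> int vec \<Rightarrow> int vec" where
  "perm_vec \<pi> t = vec (dim_vec t) (\<lambda>i. t $ \<pi> i)"

definition add_mod2 :: "int vec \<Rightarrow> int vec \<Rightarrow> int vec" where
  "add_mod2 z t = vec (dim_vec t) (\<lambda>i. (z $ i + t $ i) mod 2)"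

text \<open>Inserting zero rows moves row \<open>j\<close> of the identity matrix to some position \<open>k j\<close>,
  with the order of these rows unchanged.\<close>

definition embedding_matrix :: "nat \<Rightarrow> nat \<Rightarrow> int mat \<Rightarrow> bool" where
  "embedding_matrix n q M \<longleftrightarrow>
     M \<in> carrier_mat n q \<and>
     (\<exists>k. strict_mono_on {..<q} k \<and> k ` {..<q} \<subseteq> {..<n} \<and>
        (\<forall>j < q. row M (k j) = row (1\<^sub>m q) j) \<and>
        (\<forall>i \<in> {..<n} - k ` {..<q}. row M i = 0\<^sub>v q))"

text \<open>For an injective singular cube \<open>\<sigma>\<close> in \<open>X\<close> the representation is unique, and
  \<open>x\<close> is a value of \<open>\<sigma>\<close>, hence a point of \<open>X\<close>.\<close>

definition orientation :: "nat \<Rightarrow> (int vec \<Rightarrow> int vec) \<Rightarrow> int" where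
  "orientation q \<sigma> =
     (THE s. \<exists>n M z \<pi> x.
        embedding_matrix n q M \<and> z \<in> unit_cube q \<and> \<pi> permutes {..<q} \<and> x \<in> carrier_vec n \<and>
        (\<forall>t \<in> unit_cube q. \<sigma> t = M *\<^sub>v add_mod2 z (perm_vec \<pi> t) + x) \<and>
        s = (- 1) ^ card {i. i < q \<and> z $ i \<noteq> 0} * sign \<pi>)"

definition beta :: "nat \<Rightarrow> (int vec \<Rightarrow> int vec) \<Rightarrow> (int vec set \<Rightarrow>\<^sub>0 int)" where
  "beta q \<sigma> =
     (if inj_on \<sigma> (unit_cube q)
      then frag_cmul (orientation q \<sigma>) (frag_of (\<sigma> ` unit_cube q))
      else 0)"


section \<open>Induced maps\<close>

definition lex_min :: "int vec set \<Rightarrow> int vec" where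
  "lex_min Q =
     (THE x. x \<in> Q \<and>
        (\<forall>y \<in> Q. y \<noteq> x \<longrightarrow> (list_of_vec x, list_of_vec y) \<in> lexord {(a, b). a < b}))"

definition cube_param :: "int vec set \<Rightarrow> int vec \<Rightarrow> int vec" where
  "cube_param Q t =
     (let n = length (factors Q)
      in mat_of_cols n (map (unit_vec n) (nondeg_indices (factors Q))) *\<^sub>v t + lex_min Q)"

definition chain_map :: "nat \<Rightarrow> (int vec \<Rightarrow> int vec) \<Rightarrow>
    (int vec set \<Rightarrow>\<^sub>0 int) \<Rightarrow> (int vec set \<Rightarrow>\<^sub>0 int)" where
  "chain_map q f = frag_extend (\<lambda>Q. beta q (f \<circ> cube_param Q))"

text \<open>The class of \<open>c\<close> is sent to the class of \<^term>\<open>chain_map q f c\<close>; for a class \<open>a\<close>,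
  the image set below is a singleton because \<^term>\<open>chain_map q f\<close> is a chain map.\<close>

definition induced_map :: "nat \<Rightarrow> int vec set \<Rightarrow> int vec set \<Rightarrow> (int vec \<Rightarrow> int vec) \<Rightarrow>
    (int vec set \<Rightarrow>\<^sub>0 int) set \<Rightarrow> (int vec set \<Rightarrow>\<^sub>0 int) set" where
  "induced_map q X Y f =
     (\<lambda>a \<in> carrier (homology q X).
        the_elem ((\<lambda>c. boundaries q Y #>\<^bsub>chain_group q Y\<^esub> chain_map q f c) ` a))"

end

theory Submission
  imports Defs "Jordan_Normal_Form.Determinant"
begin

text \<open>
  The heart of the matter is that \<open>\<beta>\<close> commutes with the boundary of singular cubes. An injective
  cube is the standard parametrization of an elementary cube after a signed coordinate
  permutation, and the sign of a minor of a permutation matrix accounts for its faces. For a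
  noninjective \<open>\<sigma>\<close> of dimension \<open>q\<close>, the chain \<open>\<beta>(\<partial>\<sigma>)\<close> is, by induction on \<open>q\<close>, a cycle of
  dimension \<open>q - 1\<close> whose cubes lie in a set of fewer than \<open>2\<^sup>q\<close> points; but a nonzero cycle
  of that dimension has at least \<open>2\<^sup>q\<close> vertices, so it vanishes.

  Composition is preserved because the orientation is multiplicative under signed coordinate
  permutations.
\<close>


section \<open>Elementary cubes\<close>

text \<open>A noninjective cube may have injective faces, and these need not cancel against the
  opposite ones. If each diagonal of a square is sent to one of two adjacent points, opposite faces
  run through the same edge in opposite directions: they reinforce each other in the alternating sum
  and cancel only against the pair in the other direction. Counting vertices avoids any search for
  such a matching, since only the cycle property and the size of the image enter. The bound has the
  right size: the boundary of a q-cube has exactly 2^q vertices, and a noninjective cube has fewer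
  in its image.

  In dimension 0 every chain is a cycle, and a single point would violate the bound. There the sum
  of the coefficients has to vanish instead, which is why an augmentation appears.

  Signs are handled by describing a cube through its least vertex \<open>x\<close> and the set
  \<open>K\<close> of its nondegenerate coordinates. Passing to a face, singular or elementary, then
  amounts to deleting an index.\<close>

definition rank_in :: "nat set \<Rightarrow> nat \<Rightarrow> nat" where
  "rank_in K i = card {j \<in> K. j < i}"

lemma rank_in_strict_mono:
  assumes "finite K" "i \<in> K" "i < j"
  shows "rank_in K i < rank_in K j"
  unfolding rank_in_def using assms by (intro psubset_card_mono) auto

lemma rank_in_less_card: "finite K \<Longrightarrow> i \<in> K \<Longrightarrow> rank_in K i < card K"
  unfolding rank_in_def by (intro psubset_card_mono) auto

lemma inj_on_rank_in: "finite K \<Longrightarrow> inj_on (rank_in K) K"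
  by (metis inj_onI linorder_neqE_nat less_irrefl rank_in_strict_mono)

lemma bij_betw_rank_in:
  assumes "finite K"
  shows "bij_betw (rank_in K) K {..<card K}"
proof -
  have "rank_in K ` K = {..<card K}"
    using rank_in_less_card[OF assms] card_image[OF inj_on_rank_in[OF assms]]
    by (intro card_subset_eq) auto
  then show ?thesis using inj_on_rank_in[OF assms] by (simp add: bij_betw_def)
qed

lemma rank_in_nth:
  assumes "finite K" "l < card K"
  shows "rank_in K (sorted_list_of_set K ! l) = l"
proof -
  let ?xs = "sorted_list_of_set K"
  have len: "length ?xs = card K" and st: "sorted_wrt (<) ?xs" and s: "set ?xs = K"
    using assms by auto
  have "{j \<in> K. j < ?xs ! l} = (!) ?xs ` {..<l}"
  proof
    show "{j \<in> K. j < ?xs ! l} \<subseteq> (!) ?xs ` {..<l}"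
    proof
      fix j assume j: "j \<in> {j \<in> K. j < ?xs ! l}"
      then obtain m where m: "m < card K" "?xs ! m = j"
        using s len by (metis in_set_conv_nth mem_Collect_eq)
      have "m < l"
        using j m assms st len
        by (metis (mono_tags, lifting) mem_Collect_eq linorder_neqE_nat less_asym sorted_wrt_nth_less
            less_irrefl)
      then show "j \<in> (!) ?xs ` {..<l}" using m by auto
    qed
    show "(!) ?xs ` {..<l} \<subseteq> {j \<in> K. j < ?xs ! l}"
      using assms st len s by (auto simp: sorted_wrt_iff_nth_less in_set_conv_nth)
       (metis nth_mem order.strict_trans s len)
  qed
  moreover have "inj_on ((!) ?xs) {..<l}"
    using assms len by (auto intro!: inj_on_nth)
  ultimately show ?thesis
    unfolding rank_in_def by (simp add: card_image)
qed

lemma sorted_list_nth_mem: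
  assumes "finite K" "l < card K"
  shows "sorted_list_of_set K ! l \<in> K"
  using assms by (metis length_sorted_list_of_set nth_mem set_sorted_list_of_set)

lemma nth_rank_in:
  assumes "finite K" "k \<in> K"
  shows "sorted_list_of_set K ! rank_in K k = k"
  using assms by (metis inj_onD inj_on_rank_in sorted_list_nth_mem rank_in_less_card rank_in_nth)

text \<open>The given definitions sum over positions in a sorted list of directions, while faces are
  easier to compare when the sum runs over the set of directions itself.\<close>

lemma sum_over_rank:
  assumes "finite K"
  shows "(\<Sum>l<card K. f l (sorted_list_of_set K ! l)) = (\<Sum>k\<in>K. f (rank_in K k) k)"
  by (rule sum.reindex_bij_betw[OF bij_betw_rank_in[OF assms], symmetric, THEN trans])
    (auto intro!: sum.cong simp: nth_rank_in assms)

text \<open>Ranks are counts rather than list positions so that deleting \<open>k\<close> has this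
  simple effect; all comparisons between a cube and its faces rest on it.\<close>

lemma rank_in_Diff:
  assumes "finite K" "k \<in> K"
  shows "rank_in (K - {k}) i = (if k < i then rank_in K i - 1 else rank_in K i)"
proof (cases "k < i")
  case True
  then have "{j \<in> K - {k}. j < i} = {j \<in> K. j < i} - {k}" by auto
  then show ?thesis using True assms by (simp add: rank_in_def)
next
  case False
  then have "{j \<in> K - {k}. j < i} = {j \<in> K. j < i}" by auto
  then show ?thesis using False by (simp add: rank_in_def)
qed

section \<open>Elementary cubes given by a least vertex and a set of directions\<close>

definition cube :: "int vec \<Rightarrow> nat set \<Rightarrow> int vec set" where
  "cube x K = {y \<in> carrier_vec (dim_vec x).
     \<forall>i < dim_vec x. y $ i = x $ i \<or> i \<in> K \<and> y $ i = x $ i + 1}"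

definition cube_factors :: "int vec \<Rightarrow> nat set \<Rightarrow> int set list" where
  "cube_factors x K = map (\<lambda>i. if i \<in> K then {x $ i, x $ i + 1} else {x $ i}) [0..<dim_vec x]"

lemma length_cube_factors [simp]: "length (cube_factors x K) = dim_vec x"
  by (simp add: cube_factors_def)

lemma nth_cube_factors:
  "i < dim_vec x \<Longrightarrow> cube_factors x K ! i = (if i \<in> K then {x $ i, x $ i + 1} else {x $ i})"
  by (simp add: cube_factors_def)

lemma box_cube_factors: "box (cube_factors x K) = cube x K"
  by (fastforce simp: box_def cube_def nth_cube_factors split: if_splits)

lemma elementary_cube_factors: "J \<in> set (cube_factors x K) \<Longrightarrow> elementary_interval J"
  by (auto simp: cube_factors_def elementary_interval_def split: if_splits)

text \<open>A point of one factor extends to a point of the box by arbitrary choices in the other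
  factors. Hence a box remembers its factors, which is what the \<open>THE\<close> in
  \<open>factors\<close> relies on.\<close>

lemma box_proj:
  assumes "\<forall>J \<in> set Js. J \<noteq> {}" "i < length Js"
  shows "(\<lambda>v. v $ i) ` box Js = Js ! i"
proof
  show "(\<lambda>v. v $ i) ` box Js \<subseteq> Js ! i" using assms by (auto simp: box_def)
  show "Js ! i \<subseteq> (\<lambda>v. v $ i) ` box Js"
  proof
    fix a assume a: "a \<in> Js ! i"
    let ?v = "vec (length Js) (\<lambda>j. if j = i then a else SOME b. b \<in> Js ! j)"
    have "?v \<in> box Js"
      using assms a by (auto simp: box_def some_in_eq)
    then show "a \<in> (\<lambda>v. v $ i) ` box Js"
      using assms by (force simp: image_iff intro: bexI[of _ ?v])
  qed
qed

lemma box_dim: "v \<in> box Js \<Longrightarrow> dim_vec v = length Js"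
  by (auto simp: box_def)

lemma box_nonempty:
  assumes "\<forall>J \<in> set Js. J \<noteq> {}"
  shows "box Js \<noteq> {}"
proof -
  have "vec (length Js) (\<lambda>j. SOME b. b \<in> Js ! j) \<in> box Js"
    using assms by (auto simp: box_def some_in_eq)
  then show ?thesis by blast
qed

lemma box_inject:
  assumes "\<forall>J \<in> set Js. J \<noteq> {}" "\<forall>J \<in> set Js'. J \<noteq> {}" "box Js = box Js'"
  shows "Js = Js'"
proof (rule nth_equalityI)
  show "length Js = length Js'"
    using box_nonempty[OF assms(1)] box_dim assms(3) by (metis ex_in_conv)
  then show "Js ! i = Js' ! i" if "i < length Js" for i
    using box_proj assms that by metis
qed

lemma elementary_interval_nonempty: "elementary_interval J \<Longrightarrow> J \<noteq> {}"
  by (auto simp: elementary_interval_def)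

lemma factors_cube: "factors (cube x K) = cube_factors x K"
  unfolding factors_def
proof (rule the_equality)
  show "(\<forall>J\<in>set (cube_factors x K). elementary_interval J) \<and> cube x K = box (cube_factors x K)"
    using elementary_cube_factors box_cube_factors by auto
  show "Js = cube_factors x K"
    if "(\<forall>J\<in>set Js. elementary_interval J) \<and> cube x K = box Js" for Js
    using that elementary_cube_factors
    by (intro box_inject) (auto simp: box_cube_factors dest: elementary_interval_nonempty)
qed

lemma nondegenerate_pair [simp]: "nondegenerate {a, a + 1}"
  by (auto simp: nondegenerate_def)

lemma not_nondegenerate_single [simp]: "\<not> nondegenerate {a}"
  unfolding nondegenerate_def
  by (metis doubleton_eq_iff insert_absorb2 zless_add1_eq less_irrefl)

lemma nondegenerate_cube_factors:
  "i < dim_vec x \<Longrightarrow> nondegenerate (cube_factors x K ! i) \<longleftrightarrow> i \<in> K"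
  by (auto simp: nth_cube_factors)

lemma nondeg_indices_cube_factors:
  assumes "K \<subseteq> {..<dim_vec x}"
  shows "nondeg_indices (cube_factors x K) = sorted_list_of_set K"
proof -
  have "finite K" using assms finite_subset by blast
  have "nondeg_indices (cube_factors x K) = filter (\<lambda>i. i \<in> K) [0..<dim_vec x]"
    unfolding nondeg_indices_def by (auto intro!: filter_cong simp: nondegenerate_cube_factors)
  moreover have "set (filter (\<lambda>i. i \<in> K) [0..<dim_vec x]) = K" using assms by auto
  moreover have "sorted_wrt (<) (filter (\<lambda>i. i \<in> K) [0..<dim_vec x])"
    by (intro sorted_wrt_filter) auto
  ultimately show ?thesis
    using \<open>finite K\<close> by (metis sorted_list_of_set_unique distinct_card strict_sorted_iff)
qed

text \<open>The cube determines its factors; the nondegenerate ones are indexed by \<open>K\<close>,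
  and the minima give \<open>x\<close>. The bounds on \<open>K\<close> and \<open>K'\<close> matter
  because \<open>cube\<close> ignores indices beyond the dimension.\<close>

lemma cube_inject:
  assumes "cube x K = cube x' K'" "K \<subseteq> {..<dim_vec x}" "K' \<subseteq> {..<dim_vec x'}"
  shows "x = x' \<and> K = K'"
proof -
  have cf: "cube_factors x K = cube_factors x' K'"
    using assms(1) factors_cube by metis
  then have d: "dim_vec x = dim_vec x'" by (metis length_cube_factors)
  have K: "K = K'"
  proof -
    have "K = {i. i < dim_vec x \<and> nondegenerate (cube_factors x K ! i)}"
      using assms(2) by (auto simp: nondegenerate_cube_factors)
    also have "\<dots> = {i. i < dim_vec x' \<and> nondegenerate (cube_factors x' K' ! i)}"
      using cf d by simp
    also have "\<dots> = K'"
      using assms(3) by (auto simp: nondegenerate_cube_factors)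
    finally show ?thesis .
  qed
  have "x $ i = x' $ i" if "i < dim_vec x" for i
  proof -
    have "Min (cube_factors x K ! i) = x $ i" "Min (cube_factors x' K ! i) = x' $ i"
      using that d by (auto simp: nth_cube_factors)
    then show ?thesis using cf K by simp
  qed
  then show ?thesis using K d by auto
qed

text \<open>From here on an elementary cube is a pair \<open>x\<close>, \<open>K\<close>, which is
  unique by \<open>cube_inject\<close>.\<close>

lemma elementary_cube_iff:
  "elementary_cube q Q \<longleftrightarrow> (\<exists>x K. K \<subseteq> {..<dim_vec x} \<and> card K = q \<and> Q = cube x K)"
proof
  assume "elementary_cube q Q"
  then obtain Js where Js: "\<forall>J \<in> set Js. elementary_interval J"
    "length (nondeg_indices Js) = q" "Q = box Js"
    unfolding elementary_cube_def by blast
  define x where "x = vec (length Js) (\<lambda>i. Min (Js ! i))"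
  define K where "K = {i. i < length Js \<and> nondegenerate (Js ! i)}"
  have "cube_factors x K = Js"
  proof (rule nth_equalityI)
    fix i assume i: "i < length (cube_factors x K)"
    then have il: "i < length Js" by (simp add: x_def)
    have "elementary_interval (Js ! i)" using Js il by auto
    then obtain a where a: "Js ! i = {a} \<or> Js ! i = {a, a + 1}"
      by (auto simp: elementary_interval_def)
    from a show "cube_factors x K ! i = Js ! i"
      using il by (elim disjE) (simp_all add: nth_cube_factors x_def K_def)
  qed (simp add: x_def)
  moreover have Ks: "K \<subseteq> {..<dim_vec x}" by (auto simp: K_def x_def)
  ultimately show "\<exists>x K. K \<subseteq> {..<dim_vec x} \<and> card K = q \<and> Q = cube x K"
    using Js nondeg_indices_cube_factors[OF Ks] box_cube_factors[of x K]
    by (metis length_sorted_list_of_set)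
next
  assume "\<exists>x K. K \<subseteq> {..<dim_vec x} \<and> card K = q \<and> Q = cube x K"
  then obtain x K where xK: "K \<subseteq> {..<dim_vec x}" "card K = q" "Q = cube x K" by blast
  then show "elementary_cube q Q"
    unfolding elementary_cube_def
    using elementary_cube_factors[of _ x K] box_cube_factors[of x K] nondeg_indices_cube_factors[of K x]
    by (intro exI[of _ "cube_factors x K"]) auto
qed

section \<open>The standard parametrization of an elementary cube\<close>

definition param :: "int vec \<Rightarrow> nat set \<Rightarrow> int vec \<Rightarrow> int vec" where
  "param x K t = vec (dim_vec x) (\<lambda>i. x $ i + (if i \<in> K then t $ rank_in K i else 0))"

lemma dim_param [simp]: "dim_vec (param x K t) = dim_vec x"
  by (simp add: param_def)

lemma param_nth [simp]:
  "i < dim_vec x \<Longrightarrow> param x K t $ i = x $ i + (if i \<in> K then t $ rank_in K i else 0)"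
  by (simp add: param_def)

lemma base_in_cube: "x \<in> cube x K"
  by (auto simp: cube_def intro: carrier_vecI)

text \<open>Any other point of the cube first differs from \<open>x\<close> in a coordinate where it
  is larger by one.\<close>

lemma lex_min_cube: "lex_min (cube x K) = x"
  unfolding lex_min_def
proof (rule the_equality)
  have less: "(list_of_vec x, list_of_vec y) \<in> lexord {(a, b). a < b}"
    if "y \<in> cube x K" "y \<noteq> x" for y
  proof -
    have d: "dim_vec y = dim_vec x" using that by (auto simp: cube_def)
    have "\<exists>i0<dim_vec x. y $ i0 \<noteq> x $ i0"
      using eq_vecI[of x y] that(2) d by metis
    then obtain i0 where i0: "i0 < dim_vec x" "y $ i0 \<noteq> x $ i0" by blast
    \<comment> \<open>\<open>LEAST\<close> ranges over all indices; the comparison with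
      \<open>i0\<close> keeps the first difference inside the dimension.\<close>
    define i where "i = (LEAST i. y $ i \<noteq> x $ i)"
    have i: "y $ i \<noteq> x $ i" "i \<le> i0" and lt: "\<And>j. j < i \<Longrightarrow> y $ j = x $ j"
      unfolding i_def using LeastI[of "\<lambda>i. y $ i \<noteq> x $ i" i0] i0
      by (auto intro: Least_le dest: not_less_Least)
    have "i < dim_vec x" using i i0 by simp
    then have "x $ i < y $ i" using that i by (auto simp: cube_def)
    then show ?thesis
      unfolding lexord_take_index_conv
      using \<open>i < dim_vec x\<close> d lt
      by (intro disjI2 exI[of _ i]) (auto simp: nth_list_of_vec intro!: nth_equalityI)
  qed
  then show "x \<in> cube x K \<and> (\<forall>y\<in>cube x K. y \<noteq> x \<longrightarrow>
      (list_of_vec x, list_of_vec y) \<in> lexord {(a, b). a < b})"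
    using base_in_cube by blast
  fix y assume y: "y \<in> cube x K \<and> (\<forall>z\<in>cube x K. z \<noteq> y \<longrightarrow>
      (list_of_vec y, list_of_vec z) \<in> lexord {(a, b). a < b})"
  show "y = x"
  proof (rule ccontr)
    assume "y \<noteq> x"
    then have "(list_of_vec x, list_of_vec y) \<in> lexord {(a::int, b). a < b}"
      "(list_of_vec y, list_of_vec x) \<in> lexord {(a::int, b). a < b}"
      using y less base_in_cube by auto
    moreover have "asym (lexord {(a::int, b). a < b})"
      by (intro lexord_asym asymI) auto
    ultimately show False by (meson asymD)
  qed
qed

text \<open>Row \<open>i\<close> of the matrix is zero unless \<open>i \<in> K\<close>, and then its
  only entry 1 is in column \<open>rank_in K i\<close>; this is the coordinate formula
  \<open>param\<close>.\<close>

lemma cube_param_eq: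
  assumes K: "K \<subseteq> {..<dim_vec x}" and t: "dim_vec t = card K"
  shows "cube_param (cube x K) t = param x K t"
proof (rule eq_vecI)
  have fin: "finite K" using K finite_subset by blast
  let ?n = "dim_vec x" and ?ks = "sorted_list_of_set K"
  let ?M = "mat_of_cols ?n (map (unit_vec ?n) ?ks) :: int mat"
  have cp: "cube_param (cube x K) t = ?M *\<^sub>v t + x"
    by (simp add: cube_param_def factors_cube nondeg_indices_cube_factors[OF K] lex_min_cube Let_def)
  show "dim_vec (cube_param (cube x K) t) = dim_vec (param x K t)"
    by (simp add: cp)
  fix i assume "i < dim_vec (param x K t)"
  then have i: "i < ?n" by simp
  have "(?M *\<^sub>v t) $ i = (\<Sum>l<card K. ?M $$ (i, l) * t $ l)"
    using i t fin by (simp add: scalar_prod_def atLeast0LessThan)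
  also have "\<dots> = (\<Sum>l<card K. (if ?ks ! l = i then 1 else 0) * t $ l)"
    using K fin i sorted_list_nth_mem[OF fin]
    by (intro sum.cong) (auto simp: mat_of_cols_def unit_vec_def subset_iff)
  also have "\<dots> = (\<Sum>k\<in>K. (if k = i then 1 else 0) * t $ rank_in K k)"
    by (rule sum_over_rank[OF fin])
  also have "\<dots> = (if i \<in> K then t $ rank_in K i else 0)"
    using fin by (simp add: if_distrib[of "\<lambda>c. c * _"] sum.delta cong: if_cong)
  finally show "cube_param (cube x K) t $ i = param x K t $ i"
    using i by (simp add: cp)
qed

section \<open>Faces and boundary of an elementary cube\<close>

definition shift :: "int vec \<Rightarrow> nat \<Rightarrow> int \<Rightarrow> int vec" where
  "shift x k e = vec (dim_vec x) (\<lambda>i. if i = k then x $ i + e else x $ i)"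

lemma dim_shift [simp]: "dim_vec (shift x k e) = dim_vec x"
  by (simp add: shift_def)

lemma shift_nth [simp]: "i < dim_vec x \<Longrightarrow> shift x k e $ i = (if i = k then x $ i + e else x $ i)"
  by (simp add: shift_def)

text \<open>Makes the lower face the case \<open>e = 0\<close> of
  \<open>cube (shift x k e) (K - {k})\<close>, whose case \<open>e = 1\<close> is the upper face, so
  that one argument serves both.\<close>

lemma shift_0 [simp]: "shift x k 0 = x"
  by (intro eq_vecI) auto

lemma face_cube:
  assumes "K \<subseteq> {..<dim_vec x}" "k \<in> K"
  shows "face_A k (cube x K) = cube x (K - {k})"
    and "face_B k (cube x K) = cube (shift x k 1) (K - {k})"
proof -
  have k: "k < dim_vec x" using assms by auto
  have "(cube_factors x K)[k := {Min (cube_factors x K ! k)}] = cube_factors x (K - {k})"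
    using assms k by (intro nth_equalityI) (auto simp: nth_cube_factors nth_list_update)
  then show "face_A k (cube x K) = cube x (K - {k})"
    by (simp add: face_A_def factors_cube box_cube_factors)
  have "(cube_factors x K)[k := {Max (cube_factors x K ! k)}] = cube_factors (shift x k 1) (K - {k})"
    using assms k by (intro nth_equalityI) (auto simp: nth_cube_factors nth_list_update)
  then show "face_B k (cube x K) = cube (shift x k 1) (K - {k})"
    by (simp add: face_B_def factors_cube box_cube_factors)
qed

text \<open>Ranks start at 0 while the terms of the boundary are numbered from 1, hence the
  \<open>Suc\<close> in the exponent.\<close>

lemma boundary_cube:
  assumes "K \<subseteq> {..<dim_vec x}"
  shows "boundary (frag_of (cube x K)) = (\<Sum>k\<in>K. frag_cmul ((- 1) ^ Suc (rank_in K k))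
    (frag_of (cube x (K - {k})) - frag_of (cube (shift x k 1) (K - {k}))))"
proof -
  have fin: "finite K" using assms finite_subset by blast
  let ?ks = "sorted_list_of_set K"
  let ?F = "\<lambda>l k. frag_cmul ((- 1) ^ Suc l)
    (frag_of (cube x (K - {k})) - frag_of (cube (shift x k 1) (K - {k})))"
  have "boundary (frag_of (cube x K)) = (\<Sum>i = 1..card K. frag_cmul ((- 1) ^ i)
       (frag_of (face_A (?ks ! (i - 1)) (cube x K)) - frag_of (face_B (?ks ! (i - 1)) (cube x K))))"
    using fin
    by (simp add: boundary_def factors_cube nondeg_indices_cube_factors[OF assms] Let_def)
  also have "\<dots> = (\<Sum>l<card K. ?F l (?ks ! l))"
    using sorted_list_nth_mem[OF fin] assms
    by (intro sum.reindex_bij_witness[of _ Suc "\<lambda>i. i - 1"]) (auto simp: face_cube)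
  also have "\<dots> = (\<Sum>k\<in>K. ?F (rank_in K k) k)"
    by (rule sum_over_rank[OF fin])
  finally show ?thesis .
qed

section \<open>Orientation and parametrized cubes\<close>

definition indicator_vec :: "nat \<Rightarrow> nat set \<Rightarrow> int vec" where
  "indicator_vec q T = vec q (\<lambda>i. if i \<in> T then 1 else 0)"

lemma unit_cube_iff: "t \<in> unit_cube q \<longleftrightarrow> dim_vec t = q \<and> (\<forall>i<q. t $ i = 0 \<or> t $ i = 1)"
  by (auto simp: unit_cube_def intro: carrier_vecI)

lemma unit_cubeD:
  assumes "t \<in> unit_cube q"
  shows "dim_vec t = q" "i < q \<Longrightarrow> t $ i = 0 \<or> t $ i = 1"
  using assms by (auto simp: unit_cube_iff)

text \<open>Vertices become subsets. This counts them and later allows an induction on the number of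
  ones.\<close>

lemma bij_betw_indicator_vec: "bij_betw (indicator_vec q) (Pow {..<q}) (unit_cube q)"
proof (rule bij_betw_byWitness[where f' = "\<lambda>t. {i. i < q \<and> t $ i = 1}"])
  show "\<forall>a'\<in>unit_cube q. indicator_vec q {i. i < q \<and> a' $ i = 1} = a'"
    by (auto simp: unit_cube_iff indicator_vec_def intro!: eq_vecI)
qed (auto simp: unit_cube_iff indicator_vec_def split: if_splits)

lemma finite_unit_cube [simp]: "finite (unit_cube q)"
  using bij_betw_finite[OF bij_betw_indicator_vec] by simp

lemma card_unit_cube: "card (unit_cube q) = 2 ^ q"
  using bij_betw_same_card[OF bij_betw_indicator_vec] by (metis card_Pow card_lessThan finite_lessThan)

definition act :: "int vec \<Rightarrow> (nat \<Rightarrow> nat) \<Rightarrow> int vec \<Rightarrow> int vec" where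
  "act z \<pi> t = add_mod2 z (perm_vec \<pi> t)"

lemma dim_act [simp]: "dim_vec (act z \<pi> t) = dim_vec t"
  by (simp add: act_def add_mod2_def perm_vec_def)

lemma act_nth [simp]: "i < dim_vec t \<Longrightarrow> act z \<pi> t $ i = (z $ i + t $ \<pi> i) mod 2"
  by (simp add: act_def add_mod2_def perm_vec_def)

lemma act_unit_cube: "t \<in> unit_cube q \<Longrightarrow> act z \<pi> t \<in> unit_cube q"
  by (auto simp: unit_cube_iff)

lemma mod2_cancel:
  fixes a b c :: int
  assumes "(c + a) mod 2 = (c + b) mod 2" "a = 0 \<or> a = 1" "b = 0 \<or> b = 1"
  shows "a = b"
  using assms by presburger

lemma inj_on_act:
  assumes "\<pi> permutes {..<q}"
  shows "inj_on (act z \<pi>) (unit_cube q)"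
proof (rule inj_onI)
  fix s t assume st: "s \<in> unit_cube q" "t \<in> unit_cube q" "act z \<pi> s = act z \<pi> t"
  then have d: "dim_vec s = q" "dim_vec t = q" by (auto simp: unit_cube_iff)
  show "s = t"
  proof (rule eq_vecI)
    fix i assume "i < dim_vec t"
    then have "i < q" using d by simp
    then have "i \<in> \<pi> ` {..<q}" using permutes_image[OF assms] by simp
    then obtain l where l: "l < q" "\<pi> l = i" by auto
    have "(z $ l + s $ i) mod 2 = (z $ l + t $ i) mod 2"
      using arg_cong[OF st(3), of "\<lambda>v. v $ l"] l d by simp
    then show "s $ i = t $ i"
      using unit_cubeD(2)[OF st(1) \<open>i < q\<close>] unit_cubeD(2)[OF st(2) \<open>i < q\<close>]
      by (rule mod2_cancel)
  qed (simp add: d)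
qed

lemma act_image:
  assumes "\<pi> permutes {..<q}"
  shows "act z \<pi> ` unit_cube q = unit_cube q"
  using act_unit_cube inj_on_act[OF assms]
  by (intro endo_inj_surj finite_unit_cube image_subsetI)

text \<open>The origin is sent to \<open>z\<close>. The vertex whose only 1 is at place
  \<open>\<pi> l\<close> then reveals which coordinate is read at place \<open>l\<close>.\<close>

lemma act_inject:
  assumes "z \<in> unit_cube q" "z' \<in> unit_cube q" "\<pi> permutes {..<q}" "\<pi>' permutes {..<q}"
    and eq: "\<And>t. t \<in> unit_cube q \<Longrightarrow> act z \<pi> t = act z' \<pi>' t"
  shows "z = z' \<and> \<pi> = \<pi>'"
proof -
  have d: "dim_vec z = q" "dim_vec z' = q" using assms by (auto simp: unit_cube_iff)
  have in_q: "\<pi> l < q" "\<pi>' l < q" if "l < q" for l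
    using assms(3,4) that by (metis lessThan_iff permutes_in_image)+
  have zeq: "z $ l = z' $ l" if "l < q" for l
  proof -
    have "0\<^sub>v q \<in> unit_cube q" by (auto simp: unit_cube_iff)
    from arg_cong[OF eq[OF this], of "\<lambda>v. v $ l"] have "(0 + z $ l) mod 2 = (0 + z' $ l) mod 2"
      using that in_q[OF that] by simp
    then show ?thesis
      using unit_cubeD(2)[OF assms(1) that] unit_cubeD(2)[OF assms(2) that]
      by (metis mod2_cancel add_0)
  qed
  then have z: "z = z'" using d by (intro eq_vecI) auto
  have "\<pi> l = \<pi>' l" for l
  proof (cases "l < q")
    case True
    let ?t = "indicator_vec q {\<pi> l}"
    have t: "?t \<in> unit_cube q" by (auto simp: unit_cube_iff indicator_vec_def)
    have "(z $ l + ?t $ \<pi> l) mod 2 = (z $ l + ?t $ \<pi>' l) mod 2"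
      using arg_cong[OF eq[OF t], of "\<lambda>v. v $ l"] True t zeq by (simp add: unit_cube_iff)
    then have "?t $ \<pi> l = ?t $ \<pi>' l"
      using unit_cubeD(2)[OF t in_q(1)[OF True]] unit_cubeD(2)[OF t in_q(2)[OF True]]
      by (rule mod2_cancel)
    then show ?thesis
      using in_q[OF True] by (auto simp: indicator_vec_def split: if_splits)
  next
    case False
    then show ?thesis using assms(3,4) by (auto simp: permutes_def)
  qed
  then show ?thesis using z by blast
qed

lemma cubeD:
  assumes "y \<in> cube x K"
  shows "dim_vec y = dim_vec x"
    and "i < dim_vec x \<Longrightarrow> y $ i = x $ i \<or> i \<in> K \<and> y $ i = x $ i + 1"
  using assms by (auto simp: cube_def)

lemma param_image:
  assumes "K \<subseteq> {..<dim_vec x}" "card K = q"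
  shows "param x K ` unit_cube q = cube x K"
proof
  have fin: "finite K" using assms finite_subset by blast
  show "param x K ` unit_cube q \<subseteq> cube x K"
  proof
    fix y assume "y \<in> param x K ` unit_cube q"
    then obtain t where t: "t \<in> unit_cube q" "y = param x K t" by blast
    have "t $ rank_in K i = 0 \<or> t $ rank_in K i = 1" if "i \<in> K" for i
      using t(1) rank_in_less_card[OF fin that] assms(2) by (auto simp: unit_cube_iff)
    then show "y \<in> cube x K"
      unfolding t(2) cube_def by (auto intro!: carrier_vecI)
  qed
  show "cube x K \<subseteq> param x K ` unit_cube q"
  proof
    fix y assume y: "y \<in> cube x K"
    let ?ks = "sorted_list_of_set K"
    \<comment> \<open>Coordinate \<open>l\<close> of the preimage is the displacement of
      \<open>y\<close> from \<open>x\<close> along the \<open>l\<close>-th direction.\<close>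
    let ?t = "vec q (\<lambda>l. y $ (?ks ! l) - x $ (?ks ! l))"
    have "?t \<in> unit_cube q"
    proof -
      have "y $ (?ks ! l) - x $ (?ks ! l) \<in> {0, 1}" if "l < q" for l
      proof -
        have "?ks ! l \<in> K" using sorted_list_nth_mem[OF fin, of l] assms(2) that by simp
        then have "?ks ! l < dim_vec x" using assms by auto
        from cubeD(2)[OF y this] show ?thesis by auto
      qed
      then show ?thesis by (auto simp: unit_cube_iff)
    qed
    moreover have "param x K ?t = y"
    proof (rule eq_vecI)
      fix i assume "i < dim_vec y"
      then have i: "i < dim_vec x" using cubeD(1)[OF y] by simp
      show "param x K ?t $ i = y $ i"
        using i cubeD(2)[OF y i] rank_in_less_card[OF fin, of i] nth_rank_in[OF fin, of i] assms(2)
        by (cases "i \<in> K") auto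
    qed (simp add: cubeD(1)[OF y])
    ultimately show "y \<in> param x K ` unit_cube q" by (rule rev_image_eqI[OF _ sym])
  qed
qed

lemma inj_on_param:
  assumes "K \<subseteq> {..<dim_vec x}" "card K = q"
  shows "inj_on (param x K) (unit_cube q)"
proof (rule inj_onI)
  have fin: "finite K" using assms finite_subset by blast
  fix s t assume st: "s \<in> unit_cube q" "t \<in> unit_cube q" "param x K s = param x K t"
  show "s = t"
  proof (rule eq_vecI)
    fix l assume "l < dim_vec t"
    then have l: "l < card K" using st assms by (auto simp: unit_cube_iff)
    let ?k = "sorted_list_of_set K ! l"
    have "?k \<in> K" using sorted_list_nth_mem[OF fin l] .
    then have "x $ ?k + s $ rank_in K ?k = x $ ?k + t $ rank_in K ?k"
      using assms arg_cong[OF st(3), of "\<lambda>v. v $ ?k"] by auto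
    then show "s $ l = t $ l" using rank_in_nth[OF fin l] by simp
  qed (use st in \<open>auto simp: unit_cube_iff\<close>)
qed

text \<open>A strictly increasing \<open>k\<close> is the enumeration of its image, so an embedding
  matrix amounts to the set of its nonzero rows, and \<open>k j\<close> has rank \<open>j\<close> in
  that set.\<close>

lemma embedding_matrix_param:
  assumes "embedding_matrix n q M"
  obtains K where "K \<subseteq> {..<n}" "card K = q"
    "\<And>x t. x \<in> carrier_vec n \<Longrightarrow> t \<in> carrier_vec q \<Longrightarrow> M *\<^sub>v t + x = param x K t"
proof -
  from assms obtain k where M: "M \<in> carrier_mat n q" and k: "strict_mono_on {..<q} k"
    "k ` {..<q} \<subseteq> {..<n}" "\<And>j. j < q \<Longrightarrow> row M (k j) = row (1\<^sub>m q) j"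
    "\<And>i. i < n \<Longrightarrow> i \<notin> k ` {..<q} \<Longrightarrow> row M i = 0\<^sub>v q"
    unfolding embedding_matrix_def by blast
  have inj: "inj_on k {..<q}" using k(1) by (rule strict_mono_on_imp_inj_on)
  have rank: "rank_in (k ` {..<q}) (k j) = j" if "j < q" for j
  proof -
    have "i < q \<Longrightarrow> k i < k j \<longleftrightarrow> i < j" for i
      using strict_mono_on_less[OF k(1), of i j] that by simp
    then have "{i \<in> k ` {..<q}. i < k j} = k ` {..<j}"
      using that by auto
    moreover have "inj_on k {..<j}" using inj that by (auto intro: inj_on_subset)
    ultimately show ?thesis by (simp add: rank_in_def card_image)
  qed
  show thesis
  proof
    show "k ` {..<q} \<subseteq> {..<n}" by fact
    show "card (k ` {..<q}) = q" using inj by (simp add: card_image)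
    fix x t :: "int vec" assume x: "x \<in> carrier_vec n" and t: "t \<in> carrier_vec q"
    show "M *\<^sub>v t + x = param x (k ` {..<q}) t"
    proof (rule eq_vecI)
      fix i assume "i < dim_vec (param x (k ` {..<q}) t)"
      then have i: "i < n" using x by simp
      have "row M i \<bullet> t = (if i \<in> k ` {..<q} then t $ rank_in (k ` {..<q}) i else 0)"
      proof (cases "i \<in> k ` {..<q}")
        case True
        then obtain j where j: "j < q" "i = k j" by auto
        have "row M i \<bullet> t = t $ j" using k(3) j t by simp
        then show ?thesis using rank[OF j(1)] True j(2) by simp
      next
        case False
        then show ?thesis using k(4) i t by simp
      qed
      then show "(M *\<^sub>v t + x) $ i = param x (k ` {..<q}) t $ i"
        using i x M by (simp add: add.commute)
    qed (use x M in auto)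
  qed
qed

text \<open>Conversely, the matrix with a 1 in column \<open>rank_in K i\<close> of each row
  \<open>i \<in> K\<close> is an embedding matrix; the sorted list of \<open>K\<close> provides the
  positions of the inserted rows.\<close>

lemma param_embedding_matrix:
  assumes K: "K \<subseteq> {..<n}" "card K = q"
  obtains M where "embedding_matrix n q M"
    "\<And>x t. x \<in> carrier_vec n \<Longrightarrow> t \<in> carrier_vec q \<Longrightarrow> M *\<^sub>v t + x = param x K t"
proof
  have fin: "finite K" using K finite_subset by blast
  let ?M = "mat n q (\<lambda>(i, j). if i \<in> K \<and> rank_in K i = j then 1 else (0::int))"
  let ?k = "\<lambda>l. sorted_list_of_set K ! l"
  have M: "?M \<in> carrier_mat n q" by simp
  have im: "?k ` {..<q} = K"
    using fin K by (metis nth_image length_sorted_list_of_set set_sorted_list_of_set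
        lessThan_atLeast0 le_refl take_all)
  show e: "embedding_matrix n q ?M"
    unfolding embedding_matrix_def
  proof (intro conjI exI[of _ ?k])
    show "strict_mono_on {..<q} ?k"
      using K fin strict_sorted_list_of_set[of K]
      by (auto simp: strict_mono_on_def intro: sorted_wrt_nth_less)
    show "?k ` {..<q} \<subseteq> {..<n}" using im K by simp
    show "\<forall>j<q. row ?M (?k j) = row (1\<^sub>m q) j"
    proof (intro allI impI eq_vecI)
      fix j i assume j: "j < q" and "i < dim_vec (row (1\<^sub>m q) j)"
      then have i: "i < q" by simp
      have "?k j \<in> K" using j K sorted_list_nth_mem[OF fin, of j] by simp
      then show "row ?M (?k j) $ i = row (1\<^sub>m q) j $ i"
        using i j K rank_in_nth[OF fin] by (auto simp: subset_iff)
    qed simp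
    show "\<forall>i\<in>{..<n} - ?k ` {..<q}. row ?M i = 0\<^sub>v q"
      unfolding im by (auto intro!: eq_vecI)
  qed simp
  fix x t :: "int vec" assume x: "x \<in> carrier_vec n" and t: "t \<in> carrier_vec q"
  show "?M *\<^sub>v t + x = param x K t"
  proof (rule eq_vecI)
    fix i assume "i < dim_vec (param x K t)"
    then have i: "i < n" using x by simp
    have "(?M *\<^sub>v t) $ i = (\<Sum>j<q. (if i \<in> K \<and> rank_in K i = j then t $ j else 0))"
      using i t by (auto simp: scalar_prod_def atLeast0LessThan intro!: sum.cong)
    also have "\<dots> = (if i \<in> K then t $ rank_in K i else 0)"
      using rank_in_less_card[OF fin] K by (simp add: sum.delta)
    finally show "(?M *\<^sub>v t + x) $ i = param x K t $ i"
      using i x by (simp add: add.commute)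
  qed (use x in auto)
qed

section \<open>Orientation and \<open>\<beta>\<close> of a parametrized cube\<close>

definition orient_sign :: "nat \<Rightarrow> int vec \<Rightarrow> (nat \<Rightarrow> nat) \<Rightarrow> int" where
  "orient_sign q z \<pi> = (- 1) ^ card {i. i < q \<and> z $ i \<noteq> 0} * sign \<pi>"

lemma param_act_image:
  assumes "K \<subseteq> {..<dim_vec x}" "card K = q" "\<pi> permutes {..<q}"
    "\<And>t. t \<in> unit_cube q \<Longrightarrow> \<sigma> t = param x K (act z \<pi> t)"
  shows "\<sigma> ` unit_cube q = cube x K"
proof -
  have "\<sigma> ` unit_cube q = param x K ` act z \<pi> ` unit_cube q"
    using assms(4) by (simp add: image_image)
  then show ?thesis using param_image act_image assms by simp
qed

text \<open>The common image is a cube and so determines \<open>x\<close> and \<open>K\<close>.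
  Since \<open>param x K\<close> is injective, the two symmetries then agree on the unit cube, and
  \<open>act_inject\<close> applies.\<close>

lemma param_act_inject:
  assumes "K \<subseteq> {..<dim_vec x}" "card K = q" "\<pi> permutes {..<q}" "z \<in> unit_cube q"
    "K' \<subseteq> {..<dim_vec x'}" "card K' = q" "\<pi>' permutes {..<q}" "z' \<in> unit_cube q"
    and eq: "\<And>t. t \<in> unit_cube q \<Longrightarrow> param x K (act z \<pi> t) = param x' K' (act z' \<pi>' t)"
  shows "x = x' \<and> K = K' \<and> z = z' \<and> \<pi> = \<pi>'"
proof -
  have "cube x K = cube x' K'"
    using param_act_image[OF assms(1-3), of "\<lambda>t. param x K (act z \<pi> t)"]
      param_act_image[OF assms(5-7), of "\<lambda>t. param x K (act z \<pi> t)"] eq by metis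
  then have *: "x = x'" "K = K'" using cube_inject assms by blast+
  have "act z \<pi> t = act z' \<pi>' t" if "t \<in> unit_cube q" for t
    using inj_on_param[OF assms(1,2)] eq[OF that] that act_unit_cube unfolding *
    by (metis inj_onD)
  then show ?thesis using act_inject assms * by blast
qed

text \<open>Uniqueness of the representation, translated through embedding matrices, gives the
  \<open>THE\<close> in \<open>orientation\<close> its value.\<close>

lemma orientation_param_act:
  assumes K: "K \<subseteq> {..<dim_vec x}" "card K = q" "\<pi> permutes {..<q}" "z \<in> unit_cube q"
    and eq: "\<And>t. t \<in> unit_cube q \<Longrightarrow> \<sigma> t = param x K (act z \<pi> t)"
  shows "orientation q \<sigma> = orient_sign q z \<pi>"
proof -
  have carr: "add_mod2 z (perm_vec \<pi> t) \<in> carrier_vec q" if "t \<in> unit_cube q" for z \<pi> t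
    using act_unit_cube[OF that] unfolding act_def by (auto simp: unit_cube_def)
  show ?thesis
    unfolding orientation_def
  proof (rule the_equality)
    obtain M where M: "embedding_matrix (dim_vec x) q M"
      "\<And>y t. y \<in> carrier_vec (dim_vec x) \<Longrightarrow> t \<in> carrier_vec q \<Longrightarrow> M *\<^sub>v t + y = param y K t"
      using param_embedding_matrix K by blast
    then show "\<exists>n M z' \<pi>' x. embedding_matrix n q M \<and> z' \<in> unit_cube q \<and> \<pi>' permutes {..<q} \<and>
        x \<in> carrier_vec n \<and> (\<forall>t\<in>unit_cube q. \<sigma> t = M *\<^sub>v add_mod2 z' (perm_vec \<pi>' t) + x) \<and>
        orient_sign q z \<pi> = (- 1) ^ card {i. i < q \<and> z' $ i \<noteq> 0} * sign \<pi>'"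
      using K carr eq
      by (intro exI[of _ "dim_vec x"] exI[of _ M] exI[of _ z] exI[of _ \<pi>] exI[of _ x])
        (auto simp: orient_sign_def act_def)
    fix s
    assume "\<exists>n M z \<pi> x. embedding_matrix n q M \<and> z \<in> unit_cube q \<and> \<pi> permutes {..<q} \<and>
        x \<in> carrier_vec n \<and> (\<forall>t\<in>unit_cube q. \<sigma> t = M *\<^sub>v add_mod2 z (perm_vec \<pi> t) + x) \<and>
        s = (- 1) ^ card {i. i < q \<and> z $ i \<noteq> 0} * sign \<pi>"
    then obtain n M' z' \<pi>' x' where M': "embedding_matrix n q M'" "z' \<in> unit_cube q"
      "\<pi>' permutes {..<q}" "x' \<in> carrier_vec n"
      "\<And>t. t \<in> unit_cube q \<Longrightarrow> \<sigma> t = M' *\<^sub>v add_mod2 z' (perm_vec \<pi>' t) + x'"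
      "s = (- 1) ^ card {i. i < q \<and> z' $ i \<noteq> 0} * sign \<pi>'" by blast
    obtain K' where K': "K' \<subseteq> {..<n}" "card K' = q"
      "\<And>x t. x \<in> carrier_vec n \<Longrightarrow> t \<in> carrier_vec q \<Longrightarrow> M' *\<^sub>v t + x = param x K' t"
      using embedding_matrix_param[OF M'(1)] by blast
    have "x = x' \<and> K = K' \<and> z = z' \<and> \<pi> = \<pi>'"
      using K K' M' carr eq[symmetric] by (intro param_act_inject[of K x q]) (auto simp: act_def)
    then show "s = orient_sign q z \<pi>" using M'(6) by (simp add: orient_sign_def)
  qed
qed

text \<open>Any representation at hand may be used to evaluate \<open>\<beta>\<close>, so later
  computations only have to exhibit one.\<close>

lemma beta_param_act:
  assumes K: "K \<subseteq> {..<dim_vec x}" "card K = q" "\<pi> permutes {..<q}" "z \<in> unit_cube q"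
    and eq: "\<And>t. t \<in> unit_cube q \<Longrightarrow> \<sigma> t = param x K (act z \<pi> t)"
  shows "inj_on \<sigma> (unit_cube q)"
    and "beta q \<sigma> = frag_cmul (orient_sign q z \<pi>) (frag_of (cube x K))"
proof -
  have "inj_on (param x K \<circ> act z \<pi>) (unit_cube q)"
    using inj_on_act[OF K(3)] inj_on_param[OF K(1,2)] act_image[OF K(3)]
    by (intro comp_inj_on) auto
  then show "inj_on \<sigma> (unit_cube q)"
    using eq by (subst inj_on_cong[of _ _ "param x K \<circ> act z \<pi>"]) auto
  then show "beta q \<sigma> = frag_cmul (orient_sign q z \<pi>) (frag_of (cube x K))"
    using orientation_param_act[OF assms] param_act_image[OF K(1-3) eq] by (simp add: beta_def)
qed

section \<open>Injective singular cubes\<close>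

lemma c1_continuousD:
  assumes "c1_continuous X Y f"
  shows "x \<in> X \<Longrightarrow> f x \<in> Y"
    and "x \<in> X \<Longrightarrow> y \<in> X \<Longrightarrow> c1_adjacent x y \<Longrightarrow> f x = f y \<or> c1_adjacent (f x) (f y)"
  using assms unfolding c1_continuous_def by blast+

text \<open>Adjacency as a unit displacement from \<open>x\<close>, so that successive steps can be
  added up.\<close>

lemma c1_adjacent_iff:
  "c1_adjacent x y \<longleftrightarrow> dim_vec x = dim_vec y \<and>
     (\<exists>i < dim_vec x. \<exists>e. \<bar>e\<bar> = 1 \<and> (\<forall>j < dim_vec x. y $ j = x $ j + (if j = i then e else 0)))"
proof
  assume "c1_adjacent x y"
  then obtain i where i: "dim_vec x = dim_vec y" "i < dim_vec x" "\<bar>x $ i - y $ i\<bar> = 1"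
    "\<forall>j < dim_vec x. j \<noteq> i \<longrightarrow> x $ j = y $ j"
    unfolding c1_adjacent_def by blast
  have "\<bar>y $ i - x $ i\<bar> = 1" using i(3) by arith
  moreover have "\<forall>j < dim_vec x. y $ j = x $ j + (if j = i then y $ i - x $ i else 0)"
    using i(4) by auto
  ultimately show "dim_vec x = dim_vec y \<and>
     (\<exists>i < dim_vec x. \<exists>e. \<bar>e\<bar> = 1 \<and> (\<forall>j < dim_vec x. y $ j = x $ j + (if j = i then e else 0)))"
    using i(1,2) by blast
next
  assume "dim_vec x = dim_vec y \<and>
     (\<exists>i < dim_vec x. \<exists>e. \<bar>e\<bar> = 1 \<and> (\<forall>j < dim_vec x. y $ j = x $ j + (if j = i then e else 0)))"
  then show "c1_adjacent x y"
    unfolding c1_adjacent_def by fastforce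
qed

text \<open>Two distinct neighbours of \<open>p\<close> on the same axis lie on opposite sides of
  \<open>p\<close> and have no other common neighbour. On different axes, their only other common
  neighbour is the opposite corner of the square that they span with \<open>p\<close>.\<close>

lemma common_neighbour:
  fixes p a b y :: "nat \<Rightarrow> int"
  assumes a: "\<And>r. r < n \<Longrightarrow> a r = p r + (if r = k then e else 0)" "k < n" "\<bar>e\<bar> = 1"
    and b: "\<And>r. r < n \<Longrightarrow> b r = p r + (if r = l then f else 0)" "l < n" "\<bar>f\<bar> = 1"
    and ya: "\<And>r. r < n \<Longrightarrow> y r = a r + (if r = m then g else 0)" "m < n" "\<bar>g\<bar> = 1"
    and yb: "\<And>r. r < n \<Longrightarrow> y r = b r + (if r = m' then h else 0)" "m' < n" "\<bar>h\<bar> = 1"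
    and ne: "\<exists>r<n. a r \<noteq> b r" "\<exists>r<n. y r \<noteq> p r"
  shows "k \<noteq> l \<and> (\<forall>r<n. y r = p r + (if r = k then e else 0) + (if r = l then f else 0))"
proof -
  have eq: "(if r = k then e else 0) + (if r = m then g else 0) =
      (if r = l then f else 0) + (if r = m' then h else 0)" if "r < n" for r
    using a(1)[OF that] b(1)[OF that] ya(1)[OF that] yb(1)[OF that] by linarith
  have nz: "e \<noteq> 0" "f \<noteq> 0" "g \<noteq> 0" "h \<noteq> 0" using assms by auto
  have kl: "k \<noteq> l"
  proof
    assume [simp]: "k = l"
    have "e \<noteq> f" using ne(1) a(1) b(1) by auto
    with \<open>\<bar>e\<bar> = 1\<close> \<open>\<bar>f\<bar> = 1\<close> have ef: "f = - e" by auto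
    have "m = k"
      using eq[of m] eq[of k] ef nz assms(3,9) ya(2) a(2) by (auto split: if_splits)
    moreover have "m' = k"
      using eq[of m'] eq[of k] ef nz assms(3,12) yb(2) a(2) by (auto split: if_splits)
    ultimately have "g = - e" using eq[of k] ef a(2,3) ya(3) yb(3) by auto
    then show False using \<open>m = k\<close> ne(2) a(1) ya(1) by (auto split: if_splits)
  qed
  moreover have "m = l"
  proof (rule ccontr)
    assume "m \<noteq> l"
    then have "m' = l" using eq[of l] kl nz b(2) by (auto split: if_splits)
    then have "m = k" using eq[of k] kl nz a(2) by (auto split: if_splits)
    then have "g = - e" using eq[of k] kl \<open>m' = l\<close> a(2) by auto
    then show False using \<open>m = k\<close> ne(2) a(1) ya(1) by (auto split: if_splits)
  qed
  moreover have "g = f"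
  proof -
    have "m' = k" using eq[of k] kl \<open>m = l\<close> nz a(2) by (auto split: if_splits)
    then show ?thesis using eq[of l] kl \<open>m = l\<close> b(2) by auto
  qed
  ultimately show ?thesis using a(1) ya(1) by auto
qed

lemma indicator_unit_cube [simp]: "indicator_vec q T \<in> unit_cube q"
  by (auto simp: unit_cube_iff indicator_vec_def)

lemma indicator_adjacent:
  assumes "i < q" "i \<notin> T"
  shows "c1_adjacent (indicator_vec q T) (indicator_vec q (insert i T))"
  unfolding c1_adjacent_iff
proof (intro conjI exI[of _ i] exI[of _ "1::int"])
qed (use assms in \<open>auto simp: indicator_vec_def\<close>)

lemma indicator_inject:
  assumes "indicator_vec q S = indicator_vec q T" "S \<subseteq> {..<q}" "T \<subseteq> {..<q}"
  shows "S = T"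
  using bij_betw_indicator_vec assms unfolding bij_betw_def by (meson PowI inj_onD)

lemma indicator_surj:
  assumes "t \<in> unit_cube q"
  obtains T where "T \<subseteq> {..<q}" "t = indicator_vec q T"
  using bij_betw_indicator_vec assms unfolding bij_betw_def by blast

text \<open>The images of the origin and its neighbours determine all others: each further vertex is
  the fourth corner of a square whose other corners have fewer ones, and
  \<open>common_neighbour\<close> forces its image.\<close>

lemma injective_cube_affine:
  assumes cont: "c1_continuous (unit_cube q) (carrier_vec n) \<sigma>" and inj: "inj_on \<sigma> (unit_cube q)"
  obtains \<kappa> \<epsilon> where "inj_on \<kappa> {..<q}" "\<kappa> ` {..<q} \<subseteq> {..<n}" "\<And>i. i < q \<Longrightarrow> \<bar>\<epsilon> i\<bar> = (1::int)"
    "\<And>T r. T \<subseteq> {..<q} \<Longrightarrow> r < n \<Longrightarrow> \<sigma> (indicator_vec q T) $ r =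
       \<sigma> (indicator_vec q {}) $ r + (\<Sum>i\<in>T. if r = \<kappa> i then \<epsilon> i else 0)"
proof -
  define s where "s T = \<sigma> (indicator_vec q T)" for T
  have dim: "dim_vec (s T) = n" for T
    using c1_continuousD(1)[OF cont indicator_unit_cube] by (simp add: s_def)
  have s_inj: "s S = s T \<longleftrightarrow> S = T" if "S \<subseteq> {..<q}" "T \<subseteq> {..<q}" for S T
    using inj that indicator_inject indicator_unit_cube unfolding s_def by (meson inj_onD)
  have neq: "\<exists>r<n. s S $ r \<noteq> s T $ r" if "S \<subseteq> {..<q}" "T \<subseteq> {..<q}" "S \<noteq> T" for S T
  proof (rule ccontr)
    assume "\<not> ?thesis"
    then have "s S = s T" using dim by (intro eq_vecI) auto
    then show False using s_inj[OF that(1,2)] that(3) by simp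
  qed
  \<comment> \<open>Injectivity rules out the case of equal values in continuity, so each added
    element moves the image by a unit step.\<close>
  have step: "\<exists>m<n. \<exists>g. \<bar>g\<bar> = 1 \<and> (\<forall>r<n. s (insert i T) $ r = s T $ r + (if r = m then g else 0))"
    if "i < q" "i \<notin> T" "T \<subseteq> {..<q}" for i T
  proof -
    have "s T \<noteq> s (insert i T)" using s_inj[of T "insert i T"] that by auto
    then have "c1_adjacent (s T) (s (insert i T))"
      using c1_continuousD(2)[OF cont indicator_unit_cube indicator_unit_cube indicator_adjacent[OF that(1,2)]]
      unfolding s_def by blast
    then show ?thesis unfolding c1_adjacent_iff dim by simp
  qed
  have "\<forall>i\<in>{..<q}. \<exists>mg. fst mg < n \<and> \<bar>snd mg\<bar> = 1 \<and>
      (\<forall>r<n. s {i} $ r = s {} $ r + (if r = fst mg then snd mg else 0))"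
    using step[of _ "{}"] by fastforce
  then obtain mg where mg: "\<forall>i\<in>{..<q}. fst (mg i) < n \<and> \<bar>snd (mg i)\<bar> = (1::int) \<and>
      (\<forall>r<n. s {i} $ r = s {} $ r + (if r = fst (mg i) then snd (mg i) else 0))"
    by (rule bchoice[THEN exE])
  define \<kappa> where "\<kappa> i = fst (mg i)" for i
  define \<epsilon> where "\<epsilon> i = snd (mg i)" for i
  have k: "\<kappa> i < n" "\<bar>\<epsilon> i\<bar> = 1" "\<And>r. r < n \<Longrightarrow> s {i} $ r = s {} $ r + (if r = \<kappa> i then \<epsilon> i else 0)"
    if "i < q" for i
    using mg that unfolding \<kappa>_def \<epsilon>_def by auto
  \<comment> \<open>One square of the domain: the steps at \<open>S\<close> carry over to the
    opposite corner, and the two axes are seen to differ.\<close>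
  have square: "\<kappa> i \<noteq> \<kappa> j \<and> (\<forall>r<n. s (insert i (insert j S)) $ r =
      s S $ r + (if r = \<kappa> i then \<epsilon> i else 0) + (if r = \<kappa> j then \<epsilon> j else 0))"
    if ij: "i < q" "j < q" "i \<noteq> j" "i \<notin> S" "j \<notin> S" "S \<subseteq> {..<q}"
      and Si: "\<And>r. r < n \<Longrightarrow> s (insert i S) $ r = s S $ r + (if r = \<kappa> i then \<epsilon> i else 0)"
      and Sj: "\<And>r. r < n \<Longrightarrow> s (insert j S) $ r = s S $ r + (if r = \<kappa> j then \<epsilon> j else 0)"
    for i j S
  proof -
    obtain m g where m: "m < n" "\<bar>g\<bar> = 1" "\<And>r. r < n \<Longrightarrow>
        s (insert i (insert j S)) $ r = s (insert i S) $ r + (if r = m then g else 0)"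
      using step[of j "insert i S"] ij by (auto simp: insert_commute)
    obtain m' h where m': "m' < n" "\<bar>h\<bar> = 1" "\<And>r. r < n \<Longrightarrow>
        s (insert i (insert j S)) $ r = s (insert j S) $ r + (if r = m' then h else 0)"
      using step[of i "insert j S"] ij by auto
    show ?thesis
      by (rule common_neighbour[OF Si k(1,2)[OF ij(1)] Sj k(1,2)[OF ij(2)] m(3,1,2) m'(3,1,2)])
        (use ij in \<open>auto intro!: neq\<close>)
  qed
  have main: "\<forall>r<n. s T $ r = s {} $ r + (\<Sum>i\<in>T. if r = \<kappa> i then \<epsilon> i else 0)"
    if "T \<subseteq> {..<q}" for T
    using that
  proof (induction "card T" arbitrary: T rule: less_induct)
    case less
    have fin: "finite T" using less.prems finite_subset by blast
    show ?case
    \<comment> \<open>With two distinct elements available, the square over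
      \<open>T - {i, j}\<close> applies; smaller sets are the base of the induction.\<close>
    proof (cases "\<exists>i\<in>T. \<exists>j\<in>T. i \<noteq> j")
      case True
      then obtain i j where ij: "i \<in> T" "j \<in> T" "i \<noteq> j" by blast
      define S where "S = T - {i, j}"
      have T: "T = insert i (insert j S)" and S: "i \<notin> S" "j \<notin> S" "S \<subseteq> {..<q}" "finite S"
        using ij fin less.prems unfolding S_def by auto
      have q: "i < q" "j < q" using ij less.prems by auto
      have c: "card T = Suc (Suc (card S))" using T S ij by simp
      have IS: "\<forall>r<n. s S $ r = s {} $ r + (\<Sum>i\<in>S. if r = \<kappa> i then \<epsilon> i else 0)"
        by (rule less.hyps) (use c S in auto)
      have "\<forall>r<n. s (insert i S) $ r = s {} $ r + (\<Sum>i\<in>insert i S. if r = \<kappa> i then \<epsilon> i else 0)"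
        by (rule less.hyps) (use c S q in auto)
      moreover
      have "\<forall>r<n. s (insert j S) $ r = s {} $ r + (\<Sum>i\<in>insert j S. if r = \<kappa> i then \<epsilon> i else 0)"
        by (rule less.hyps) (use c S q in auto)
      ultimately show ?thesis
        using square[of i j S] IS S ij q unfolding T by simp
    next
      case False
      then consider "T = {}" | i where "T = {i}" by blast
      then show ?thesis using k less.prems by cases auto
    qed
  qed
  show thesis
  proof
    show "inj_on \<kappa> {..<q}"
      \<comment> \<open>The square at the origin already separates the axes of any two
        directions.\<close>
      using square[of _ _ "{}"] k by (intro inj_onI) (metis empty_iff empty_subsetI lessThan_iff)
    show "\<kappa> ` {..<q} \<subseteq> {..<n}" using k by auto
    show "\<bar>\<epsilon> i\<bar> = 1" if "i < q" for i using k that by auto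
    show "\<sigma> (indicator_vec q T) $ r =
       \<sigma> (indicator_vec q {}) $ r + (\<Sum>i\<in>T. if r = \<kappa> i then \<epsilon> i else 0)"
      if "T \<subseteq> {..<q}" "r < n" for T r
      using main that unfolding s_def by blast
  qed
qed

text \<open>Direction \<open>i\<close> of the domain moves the image along the axis
  \<open>\<kappa> i\<close> with sign \<open>\<epsilon> i\<close>. Sorting the axes yields the
  permutation, and the negative signs yield the flips.\<close>

lemma injective_cube_param:
  assumes cont: "c1_continuous (unit_cube q) (carrier_vec n) \<sigma>" and inj: "inj_on \<sigma> (unit_cube q)"
  obtains x K z \<pi> where "x \<in> carrier_vec n" "K \<subseteq> {..<dim_vec x}" "card K = q"
    "\<pi> permutes {..<q}" "z \<in> unit_cube q"
    "\<And>t. t \<in> unit_cube q \<Longrightarrow> \<sigma> t = param x K (act z \<pi> t)"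
proof -
  obtain \<kappa> \<epsilon> where k: "inj_on \<kappa> {..<q}" "\<kappa> ` {..<q} \<subseteq> {..<n}" "\<And>i. i < q \<Longrightarrow> \<bar>\<epsilon> i\<bar> = (1::int)"
    and s: "\<And>T r. T \<subseteq> {..<q} \<Longrightarrow> r < n \<Longrightarrow> \<sigma> (indicator_vec q T) $ r =
       \<sigma> (indicator_vec q {}) $ r + (\<Sum>i\<in>T. if r = \<kappa> i then \<epsilon> i else 0)"
    by (rule injective_cube_affine[OF assms]) (rule that)
  define p where "p = \<sigma> (indicator_vec q {})"
  define K where "K = \<kappa> ` {..<q}"
  have cK: "card K = q" and fin: "finite K" using k(1) by (auto simp: K_def card_image)
  \<comment> \<open>The parameter coordinate of the standard cube that corresponds to direction
    \<open>i\<close> of the domain.\<close>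
  define \<mu> where "\<mu> = rank_in K \<circ> \<kappa>"
  have "bij_betw \<kappa> {..<q} K" using k(1) by (simp add: bij_betw_def K_def)
  then have \<mu>: "bij_betw \<mu> {..<q} {..<q}"
    unfolding \<mu>_def using bij_betw_rank_in[OF fin] cK by (auto intro: bij_betw_trans)
  \<comment> \<open>In \<open>act\<close>, place \<open>l\<close> reads coordinate
    \<open>\<pi> l\<close>, hence the inverse of \<open>\<mu>\<close>; the values beyond
    \<open>q\<close> are those that \<open>permutes\<close> demands.\<close>
  define \<pi> where "\<pi> l = (if l < q then inv_into {..<q} \<mu> l else l)" for l
  have \<pi>: "\<pi> permutes {..<q}"
  proof (rule bij_imp_permutes)
    show "bij_betw \<pi> {..<q} {..<q}"
      using bij_betw_inv_into[OF \<mu>] by (rule bij_betw_cong[THEN iffD1, rotated]) (simp add: \<pi>_def)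
  qed (simp add: \<pi>_def)
  have \<pi>\<mu>: "\<pi> (rank_in K (\<kappa> i)) = i" if "i < q" for i
    using that \<mu> bij_betw_inv_into_left[OF \<mu>, of i]
    by (auto simp: \<pi>_def \<mu>_def bij_betw_def)
  \<comment> \<open>Along an axis where the image decreases, the parameter is flipped and the least
    vertex \<open>x\<close> lies one below the image of the origin.\<close>
  define z where "z = vec q (\<lambda>l. if \<epsilon> (\<pi> l) = -1 then 1 else 0 :: int)"
  define x where "x = vec n (\<lambda>r. p $ r - (if \<exists>i<q. \<kappa> i = r \<and> \<epsilon> i = -1 then 1 else 0))"
  have dim: "dim_vec (\<sigma> t) = n" if "t \<in> unit_cube q" for t
    using c1_continuousD(1)[OF cont that] by simp
  show thesis
  proof
    show "x \<in> carrier_vec n" by (simp add: x_def)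
    show "K \<subseteq> {..<dim_vec x}" using k(2) by (simp add: x_def K_def)
    show "card K = q" "\<pi> permutes {..<q}" by fact+
    show "z \<in> unit_cube q" by (auto simp: z_def unit_cube_iff)
    fix t assume t: "t \<in> unit_cube q"
    obtain T where T: "T \<subseteq> {..<q}" "t = indicator_vec q T" using indicator_surj[OF t] by blast
    have finT: "finite T" using T finite_subset by blast
    show "\<sigma> t = param x K (act z \<pi> t)"
    proof (rule eq_vecI)
      show "dim_vec (\<sigma> t) = dim_vec (param x K (act z \<pi> t))" using dim t by (simp add: x_def)
      fix r assume "r < dim_vec (param x K (act z \<pi> t))"
      then have r: "r < n" by (simp add: x_def)
      show "\<sigma> t $ r = param x K (act z \<pi> t) $ r"
      proof (cases "r \<in> K")
        case False
        then have "\<And>i. i < q \<Longrightarrow> r \<noteq> \<kappa> i" by (auto simp: K_def)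
        then show ?thesis
          using s[OF T(1) r] T r False
          by (auto simp: x_def p_def subset_iff intro!: sum.neutral)
      next
        case True
        then obtain i where i: "i < q" "r = \<kappa> i" by (auto simp: K_def)
        have uniq: "j = i" if "j < q" "\<kappa> j = \<kappa> i" for j
          using k(1) that i by (auto dest: inj_onD)
        have "(\<Sum>j\<in>T. if r = \<kappa> j then \<epsilon> j else 0) = (\<Sum>j\<in>T. if j = i then \<epsilon> i else 0)"
        proof (intro sum.cong refl)
          fix j assume "j \<in> T"
          then have "j < q" using T(1) by blast
          then have "r = \<kappa> j \<longleftrightarrow> j = i" using uniq[of j] i(2) by metis
          then show "(if r = \<kappa> j then \<epsilon> j else 0) = (if j = i then \<epsilon> i else 0)" by simp
        qed
        also have "\<dots> = (if i \<in> T then \<epsilon> i else 0)" using finT by simp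
        finally have L: "\<sigma> t $ r = p $ r + (if i \<in> T then \<epsilon> i else 0)"
          using s[OF T(1) r] T(2) by (simp add: p_def)
        have xr: "x $ r = p $ r - (if \<epsilon> i = -1 then 1 else 0)"
        proof -
          have "(\<exists>j<q. \<kappa> j = r \<and> \<epsilon> j = -1) \<longleftrightarrow> \<epsilon> i = -1" using uniq i by metis
          then show ?thesis using r by (simp add: x_def)
        qed
        have l: "rank_in K r < q" using rank_in_less_card[OF fin True] cK by simp
        have "act z \<pi> t $ rank_in K r = ((if \<epsilon> i = -1 then 1 else 0) + (if i \<in> T then 1 else 0)) mod 2"
          using l T \<pi>\<mu>[OF i(1)] i by (simp add: indicator_vec_def z_def)
        moreover have "param x K (act z \<pi> t) $ r = x $ r + act z \<pi> t $ rank_in K r"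
          using r True by (simp add: x_def)
        moreover have "\<epsilon> i = 1 \<or> \<epsilon> i = -1" using k(3)[OF i(1)] by arith
        ultimately show ?thesis unfolding L xr by auto
      qed
    qed
  qed
qed

section \<open>Faces of singular cubes\<close>

text \<open>Composing a singular cube with \<open>vec_insert i 0\<close> and
  \<open>vec_insert i 1\<close> gives its two faces in direction \<open>i\<close>. The shift of
  indices is the one used for matrix minors, so that the sign rules for
  \<open>permutation_insert\<close> and \<open>permutation_delete\<close> apply.\<close>

definition vec_insert :: "nat \<Rightarrow> int \<Rightarrow> int vec \<Rightarrow> int vec" where
  "vec_insert i e t = vec (Suc (dim_vec t)) (\<lambda>l. if l = i then e else t $ delete_index i l)"

lemma dim_vec_insert [simp]: "dim_vec (vec_insert i e t) = Suc (dim_vec t)"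
  by (simp add: vec_insert_def)

lemma not_in_insert_index_image: "i \<notin> insert_index i ` S"
proof
  assume "i \<in> insert_index i ` S"
  then obtain m where "i = insert_index i m" by blast
  then show False using insert_index_exclude[of i m] by simp
qed

lemma insert_index_less: "i \<le> q \<Longrightarrow> m < q \<Longrightarrow> insert_index i m < Suc q"
  by (simp add: insert_index_def)

lemma insert_index_cases:
  assumes "l < Suc q" "i \<le> q"
  obtains "l = i" | m where "m < q" "l = insert_index i m"
proof -
  consider "l < i" | "l = i" | "i < l" by linarith
  then show thesis
  proof cases
    case 1
    then show ?thesis using that(2)[of l] assms by (simp add: insert_index_def)
  next
    case 3
    then show ?thesis using that(2)[of "l - 1"] assms by (simp add: insert_index_def)
  qed (rule that(1))
qed

lemma vec_insert_nth [simp]: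
  "i \<le> dim_vec t \<Longrightarrow> vec_insert i e t $ i = e"
  "i \<le> dim_vec t \<Longrightarrow> m < dim_vec t \<Longrightarrow> vec_insert i e t $ insert_index i m = t $ m"
  by (auto simp: vec_insert_def insert_index_less)

lemma vec_eq_insertI:
  assumes "dim_vec v = Suc (dim_vec t)" "i \<le> dim_vec t" "v $ i = e"
    "\<And>m. m < dim_vec t \<Longrightarrow> v $ insert_index i m = t $ m"
  shows "v = vec_insert i e t"
proof (rule eq_vecI)
  fix l assume "l < dim_vec (vec_insert i e t)"
  then have "l < Suc (dim_vec t)" by simp
  then show "v $ l = vec_insert i e t $ l"
    using assms by (cases rule: insert_index_cases[OF _ assms(2)]) auto
qed (simp add: assms)

lemma vec_insert_unit_cube:
  assumes "t \<in> unit_cube q" "i \<le> q" "e = 0 \<or> e = 1"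
  shows "vec_insert i e t \<in> unit_cube (Suc q)"
proof -
  note t = unit_cubeD[OF assms(1)]
  have "vec_insert i e t $ l = 0 \<or> vec_insert i e t $ l = 1" if "l < Suc q" for l
    using that t assms(2,3) by (cases rule: insert_index_cases[OF that assms(2)]) auto
  then show ?thesis using t(1) by (simp add: unit_cube_iff)
qed

lemma vec_insert_adjacent:
  assumes "c1_adjacent s t" "i \<le> dim_vec s"
  shows "c1_adjacent (vec_insert i e s) (vec_insert i e t)"
proof -
  obtain m f where m: "dim_vec s = dim_vec t" "m < dim_vec s" "\<bar>f\<bar> = 1"
    "\<And>j. j < dim_vec s \<Longrightarrow> t $ j = s $ j + (if j = m then f else 0)"
    using assms(1) unfolding c1_adjacent_iff by blast
  have inj: "insert_index i a = insert_index i b \<longleftrightarrow> a = b" for a b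
    using insert_index_inj_on[of i UNIV] by (auto dest: injD)
  have "vec_insert i e t $ l = vec_insert i e s $ l + (if l = insert_index i m then f else 0)"
    if l: "l < Suc (dim_vec s)" for l
  proof (cases rule: insert_index_cases[OF l assms(2)])
    case 1
    moreover have "i \<noteq> insert_index i m" using insert_index_exclude[of i m] by metis
    ultimately show ?thesis using m(1) assms(2) by simp
  next
    case (2 a)
    then show ?thesis using m(1) m(4)[of a] assms(2) by (simp add: inj)
  qed
  moreover have "insert_index i m < Suc (dim_vec s)" using m(2) assms(2) by (rule insert_index_less[rotated])
  ultimately show ?thesis
    unfolding c1_adjacent_iff dim_vec_insert using m(1,3) by blast
qed

lemma continuous_vec_insert:
  assumes "c1_continuous (unit_cube (Suc q)) Y \<sigma>" "i \<le> q" "e = 0 \<or> e = 1"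
  shows "c1_continuous (unit_cube q) Y (\<sigma> \<circ> vec_insert i e)"
  unfolding c1_continuous_def
proof (intro conjI ballI impI)
  show "\<sigma> \<circ> vec_insert i e \<in> unit_cube q \<rightarrow> Y"
    using c1_continuousD(1)[OF assms(1)] vec_insert_unit_cube assms(2,3) by auto
  fix s t assume "s \<in> unit_cube q" "t \<in> unit_cube q" "c1_adjacent s t"
  then show "(\<sigma> \<circ> vec_insert i e) s = (\<sigma> \<circ> vec_insert i e) t
      \<or> c1_adjacent ((\<sigma> \<circ> vec_insert i e) s) ((\<sigma> \<circ> vec_insert i e) t)"
    using c1_continuousD(2)[OF assms(1)] vec_insert_unit_cube assms(2,3) vec_insert_adjacent
      unit_cubeD(1) by (metis comp_apply)
qed

text \<open>The cubical identity between iterated faces; the later direction moves up by one because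
  an earlier coordinate has been inserted.\<close>

lemma vec_insert_commute:
  assumes "i \<le> j" "j \<le> dim_vec t"
  shows "vec_insert i e (vec_insert j d t) = vec_insert (Suc j) d (vec_insert i e t)"
proof (rule sym, rule vec_eq_insertI)
  show "vec_insert (Suc j) d (vec_insert i e t) $ i = e"
    using assms by (simp add: vec_insert_def delete_index_def)
  fix m assume "m < dim_vec (vec_insert j d t)"
  then show "vec_insert (Suc j) d (vec_insert i e t) $ insert_index i m = vec_insert j d t $ m"
    using assms by (auto simp: vec_insert_def insert_index_def delete_index_def)
qed (use assms in auto)

section \<open>Symmetries and signs restricted to faces\<close>

definition vec_delete :: "nat \<Rightarrow> int vec \<Rightarrow> int vec" where
  "vec_delete j z = vec (dim_vec z - 1) (\<lambda>l. z $ insert_index j l)"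

lemma vec_delete_unit_cube:
  assumes "z \<in> unit_cube (Suc q)" "j \<le> q"
  shows "vec_delete j z \<in> unit_cube q"
  using unit_cubeD[OF assms(1)] insert_index_less[OF assms(2)]
  by (auto simp: unit_cube_iff vec_delete_def)

lemma permutation_insert_index:
  "permutation_insert i j p (insert_index i m) = insert_index j (p m)"
  by (auto simp: permutation_insert_expand insert_index_def)

text \<open>Place \<open>j\<close> of the result reads coordinate \<open>\<pi> j\<close>, so fixing
  the latter fixes the former, and a flip at \<open>j\<close> exchanges the two ends.\<close>

lemma act_face:
  assumes \<pi>: "\<pi> permutes {..<Suc q}" and j: "j \<le> q" and z: "dim_vec z = Suc q" and t: "dim_vec t = q"
  shows "act z \<pi> (vec_insert (\<pi> j) e t) =
    vec_insert j ((z $ j + e) mod 2) (act (vec_delete j z) (permutation_delete \<pi> j) t)"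
proof (rule vec_eq_insertI)
  have \<pi>j: "\<pi> j \<le> q" using permutes_in_image[OF \<pi>, of j] j by simp
  have pd: "permutation_delete \<pi> j permutes {..<q}"
    using permutation_delete_permutes[of \<pi> q j] \<pi> j by (simp add: atLeast0LessThan)
  show "act z \<pi> (vec_insert (\<pi> j) e t) $ j = (z $ j + e) mod 2"
    using j t \<pi>j by simp
  fix m assume "m < dim_vec (act (vec_delete j z) (permutation_delete \<pi> j) t)"
  then have m: "m < q" using t by simp
  have "\<pi> (insert_index j m) = permutation_insert j (\<pi> j) (permutation_delete \<pi> j) (insert_index j m)"
    using permutation_insert_delete[of \<pi> q j] \<pi> j by (simp add: atLeast0LessThan)
  also have "\<dots> = insert_index (\<pi> j) (permutation_delete \<pi> j m)"
    by (rule permutation_insert_index)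
  finally have eq: "\<pi> (insert_index j m) = insert_index (\<pi> j) (permutation_delete \<pi> j m)" .
  have "permutation_delete \<pi> j m < q" using permutes_in_image[OF pd, of m] m by simp
  then show "act z \<pi> (vec_insert (\<pi> j) e t) $ insert_index j m =
      act (vec_delete j z) (permutation_delete \<pi> j) t $ m"
    using m t z j \<pi>j insert_index_less[OF j m] by (simp add: eq vec_delete_def)
qed (use j t in auto)

text \<open>Striking out row \<open>j\<close> and column \<open>\<pi> j\<close> of the permutation
  matrix changes its determinant by the cofactor sign. A flip at \<open>j\<close> accounts for the
  remaining factor.\<close>

lemma orient_sign_face:
  assumes \<pi>: "\<pi> permutes {..<Suc q}" and j: "j \<le> q" and z: "dim_vec z = Suc q"
  shows "orient_sign (Suc q) z \<pi> = (- 1) ^ (j + \<pi> j) * (if z $ j = 0 then 1 else - 1) *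
    orient_sign q (vec_delete j z) (permutation_delete \<pi> j)"
proof -
  have pd: "permutation_delete \<pi> j permutes {0..<q}"
    using permutation_delete_permutes[of \<pi> q j] \<pi> j by (simp add: atLeast0LessThan)
  have \<pi>j: "\<pi> j < Suc q" using permutes_in_image[OF \<pi>, of j] j by simp
  have sgn: "sign \<pi> = (- 1) ^ (j + \<pi> j) * sign (permutation_delete \<pi> j)"
    using signof_permutation_insert[OF pd _ \<pi>j, of j, where ?'a = int] j
      permutation_insert_delete[of \<pi> q j] \<pi> by (simp add: atLeast0LessThan)
  let ?S = "{l. l < q \<and> vec_delete j z $ l \<noteq> 0}"
  \<comment> \<open>The flips of \<open>z\<close> are those of the face, renumbered around
    \<open>j\<close>, and possibly \<open>j\<close> itself.\<close>
  have "{i. i < Suc q \<and> z $ i \<noteq> 0} = insert_index j ` ?S \<union> (if z $ j = 0 then {} else {j})"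
    (is "?L = ?R")
  proof (rule Set.set_eqI)
    fix i
    show "i \<in> ?L \<longleftrightarrow> i \<in> ?R"
    proof (cases "i < Suc q")
      case True
      then show ?thesis
      proof (cases rule: insert_index_cases[OF True j])
        case 1
        then show ?thesis using j by (simp add: not_in_insert_index_image)
      next
        case (2 m)
        have "insert_index j m \<in> insert_index j ` ?S \<longleftrightarrow> m \<in> ?S"
          using insert_index_inj_on[of j UNIV] by (rule inj_image_mem_iff)
        then show ?thesis
          using 2 z insert_index_less[OF j 2(1)] by (simp add: vec_delete_def)
      qed
    next
      case False
      then have "i \<notin> insert_index j ` ?S" using insert_index_less[OF j] by blast
      then show ?thesis using j False by simp
    qed
  qed
  moreover have "j \<notin> insert_index j ` ?S" by (rule not_in_insert_index_image)
  moreover have "card (insert_index j ` ?S) = card ?S"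
    using insert_index_inj_on by (rule card_image)
  ultimately have "card {i. i < Suc q \<and> z $ i \<noteq> 0} = card ?S + (if z $ j = 0 then 0 else 1)"
    by (simp split del: if_split) (simp split: if_split)
  then show ?thesis by (simp add: orient_sign_def sgn)
qed

text \<open>Removing \<open>k\<close> lowers the ranks above that of \<open>k\<close> by one, and
  \<open>insert_index\<close> at that rank undoes exactly this.\<close>

lemma param_face:
  assumes K: "K \<subseteq> {..<dim_vec x}" and k: "k \<in> K" and t: "dim_vec t = card K - 1"
  shows "param x K (vec_insert (rank_in K k) e t) = param (shift x k e) (K - {k}) t"
proof (rule eq_vecI)
  have fin: "finite K" using K finite_subset by blast
  have rk: "rank_in K k \<le> dim_vec t" using rank_in_less_card[OF fin k] t by simp
  fix i assume "i < dim_vec (param (shift x k e) (K - {k}) t)"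
  then have i: "i < dim_vec x" by simp
  consider "i = k" | "i \<notin> K" | "i \<in> K" "i \<noteq> k" by blast
  then show "param x K (vec_insert (rank_in K k) e t) $ i = param (shift x k e) (K - {k}) t $ i"
  proof cases
    case 1
    then show ?thesis using i k rk by simp
  next
    case 2
    then show ?thesis using i k by auto
  next
    case 3
    have "rank_in (K - {k}) i < dim_vec t"
      using rank_in_less_card[of "K - {k}" i] 3 fin t k by simp
    moreover have "rank_in K i = insert_index (rank_in K k) (rank_in (K - {k}) i)"
      using rank_in_Diff[OF fin k, of i] rank_in_strict_mono[OF fin k, of i]
        rank_in_strict_mono[OF fin 3(1), of k] 3(2)
      by (auto simp: insert_index_def)
    ultimately show ?thesis using i 3 rk by simp
  qed
qed simp

text \<open>This is \<open>\<beta>\<close> of the boundary of a singular cube, written out directly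
  instead of through a group of singular chains. For \<open>q = 0\<close> the sum is empty, so the
  truncated \<open>q - 1\<close> does no harm.\<close>

definition singular_boundary :: "nat \<Rightarrow> (int vec \<Rightarrow> int vec) \<Rightarrow> (int vec set \<Rightarrow>\<^sub>0 int)" where
  "singular_boundary q \<sigma> = (\<Sum>i<q. frag_cmul ((- 1) ^ Suc i)
     (beta (q - 1) (\<sigma> \<circ> vec_insert i 0) - beta (q - 1) (\<sigma> \<circ> vec_insert i 1)))"

lemma frag_cmul_diff_right: "frag_cmul c (a - b) = frag_cmul c a - frag_cmul c b"
  by (rule poly_mapping_eqI) (simp add: lookup_minus right_diff_distrib)

lemma frag_cmul_minus_diff: "frag_cmul (- c) (a - b) = frag_cmul c (b - a)"
  by (rule poly_mapping_eqI) (simp add: lookup_minus algebra_simps)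

lemma boundary_cmul: "boundary (frag_cmul c x) = frag_cmul c (boundary x)"
  and boundary_diff: "boundary (x - y) = boundary x - boundary y"
  and boundary_add: "boundary (x + y) = boundary x + boundary y"
  and boundary_minus: "boundary (- x) = - boundary x"
  and boundary_0 [simp]: "boundary 0 = 0"
  and boundary_sum: "finite I \<Longrightarrow> boundary (\<Sum>i\<in>I. f i) = (\<Sum>i\<in>I. boundary (f i))"
  by (simp_all add: boundary_def frag_extend_cmul frag_extend_diff frag_extend_add frag_extend_minus
      frag_extend_sum comp_def)

lemma beta_cong:
  assumes "\<And>t. t \<in> unit_cube q \<Longrightarrow> \<sigma> t = \<tau> t"
  shows "beta q \<sigma> = beta q \<tau>"
proof -
  have "orientation q \<sigma> = orientation q \<tau>" using assms unfolding orientation_def by simp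
  moreover have "\<sigma> ` unit_cube q = \<tau> ` unit_cube q" using assms by simp
  moreover have "inj_on \<sigma> (unit_cube q) = inj_on \<tau> (unit_cube q)" using assms by (rule inj_on_cong)
  ultimately show ?thesis by (simp add: beta_def)
qed

text \<open>The symmetry carries the faces in direction \<open>\<pi> j\<close> of the domain to the
  faces in the \<open>j\<close>-th direction of the elementary cube. The cofactor sign in
  \<open>orient_sign_face\<close> converts the sign belonging to one position into that of the
  other.\<close>

lemma boundary_beta_param_act:
  assumes K: "K \<subseteq> {..<dim_vec x}" "card K = q" and \<pi>: "\<pi> permutes {..<q}" and z: "z \<in> unit_cube q"
    and eq: "\<And>t. t \<in> unit_cube q \<Longrightarrow> \<sigma> t = param x K (act z \<pi> t)"
  shows "boundary (beta q \<sigma>) = singular_boundary q \<sigma>"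
proof (cases q)
  case 0
  then have "K = {}" using K finite_subset[OF K(1)] by simp
  then show ?thesis
    using 0 beta_param_act(2)[OF assms] by (simp add: boundary_cmul boundary_cube singular_boundary_def)
next
  case (Suc m)
  have fin: "finite K" using K finite_subset by blast
  let ?ks = "sorted_list_of_set K"
  let ?o = "orient_sign q z \<pi>"
  let ?P = "\<lambda>j k. frag_cmul ((- 1) ^ Suc j)
      (frag_of (cube x (K - {k})) - frag_of (cube (shift x k 1) (K - {k})))"
  let ?F = "\<lambda>i. frag_cmul ((- 1) ^ Suc i)
      (beta m (\<sigma> \<circ> vec_insert i 0) - beta m (\<sigma> \<circ> vec_insert i 1))"
  have step: "?F (\<pi> j) = frag_cmul ?o (?P j (?ks ! j))" if "j < q" for j
  proof -
    let ?k = "?ks ! j" and ?z = "vec_delete j z" and ?p = "permutation_delete \<pi> j"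
    have k: "?k \<in> K" "rank_in K ?k = j"
      using sorted_list_nth_mem[OF fin] rank_in_nth[OF fin] that K by auto
    have jm: "j \<le> m" and \<pi>j: "\<pi> j \<le> m" using that Suc permutes_in_image[OF \<pi>, of j] by auto
    have p: "?p permutes {..<m}"
      using permutation_delete_permutes[of \<pi> m j] \<pi> Suc that by (simp add: atLeast0LessThan)
    have zd: "dim_vec z = Suc m" and zj: "z $ j = 0 \<or> z $ j = 1"
      using unit_cubeD[OF z] Suc that by auto
    have beta_face: "beta m (\<sigma> \<circ> vec_insert (\<pi> j) e) = frag_cmul (orient_sign m ?z ?p)
        (frag_of (cube (shift x ?k ((z $ j + e) mod 2)) (K - {?k})))" if e: "e = 0 \<or> e = 1" for e
    proof (rule beta_param_act(2)[OF _ _ p])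
      show "?z \<in> unit_cube m" using vec_delete_unit_cube z jm Suc by simp
      fix t assume t: "t \<in> unit_cube m"
      have "(\<sigma> \<circ> vec_insert (\<pi> j) e) t = param x K (act z \<pi> (vec_insert (\<pi> j) e t))"
        using eq vec_insert_unit_cube[OF t \<pi>j e] Suc by simp
      also have "\<dots> = param x K (vec_insert (rank_in K ?k) ((z $ j + e) mod 2) (act ?z ?p t))"
        using act_face[of \<pi> m j z t e] \<pi> Suc jm zd unit_cubeD(1)[OF t] k(2) by simp
      also have "\<dots> = param (shift x ?k ((z $ j + e) mod 2)) (K - {?k}) (act ?z ?p t)"
        using unit_cubeD(1)[OF t] Suc K(2) by (intro param_face[OF K(1) k(1)]) simp
      finally show "(\<sigma> \<circ> vec_insert (\<pi> j) e) t =
        param (shift x ?k ((z $ j + e) mod 2)) (K - {?k}) (act ?z ?p t)" .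
    qed (use K fin k Suc in auto)
    \<comment> \<open>The sign with which both faces in direction \<open>\<pi> j\<close> enter the
      singular side; it differs from the sign on the elementary side exactly when \<open>z\<close>
      flips \<open>j\<close>.\<close>
    define X where "X = (- 1) ^ Suc (\<pi> j) * orient_sign m ?z ?p"
    have "(- 1 :: int) ^ (j + \<pi> j) * (- 1) ^ Suc j = (- 1) ^ Suc (\<pi> j)"
      by (simp add: power_add)
    then have sgn: "?o * (- 1) ^ Suc j = (if z $ j = 0 then 1 else - 1) * X"
      using orient_sign_face[of \<pi> m j z] \<pi> Suc jm zd unfolding X_def
      by (simp add: mult.assoc mult.left_commute mult.commute)
    have "?F (\<pi> j) = frag_cmul X (frag_of (cube (shift x ?k (z $ j mod 2)) (K - {?k})) -
        frag_of (cube (shift x ?k ((z $ j + 1) mod 2)) (K - {?k})))"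
      unfolding X_def by (simp only: beta_face simp_thms frag_cmul_cmul frag_cmul_diff_right
          flip: frag_cmul_diff_right) (simp add: frag_cmul_diff_right)
    moreover have "frag_cmul ?o (?P j ?k) = frag_cmul ((if z $ j = 0 then 1 else - 1) * X)
        (frag_of (cube x (K - {?k})) - frag_of (cube (shift x ?k 1) (K - {?k})))"
      by (simp only: frag_cmul_cmul sgn)
    \<comment> \<open>A flip exchanges the two faces and thus negates their difference, which the
      extra factor -1 compensates.\<close>
    ultimately show ?thesis
      using zj by (elim disjE) (simp_all add: frag_cmul_minus_diff del: power_Suc)
  qed
  have "singular_boundary q \<sigma> = (\<Sum>i<q. ?F i)"
    by (simp add: singular_boundary_def Suc)
  \<comment> \<open>Permuting the summands lists the faces in the order of the directions in
    \<open>K\<close>.\<close>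
  also have "\<dots> = (\<Sum>j<q. ?F (\<pi> j))"
    by (rule sum.reindex_bij_betw[OF permutes_imp_bij[OF \<pi>], symmetric])
  also have "\<dots> = (\<Sum>j<q. frag_cmul ?o (?P j (?ks ! j)))"
    using step by (intro sum.cong) auto
  also have "\<dots> = frag_cmul ?o (\<Sum>j<card K. ?P j (?ks ! j))"
    by (simp add: frag_cmul_sum K(2))
  also have "\<dots> = frag_cmul ?o (boundary (frag_of (cube x K)))"
    unfolding boundary_cube[OF K(1)] sum_over_rank[OF fin, of ?P] ..
  also have "\<dots> = boundary (beta q \<sigma>)"
    by (simp add: beta_param_act(2)[OF assms] boundary_cmul)
  finally show ?thesis ..
qed

text \<open>Each \<open>(i, j)\<close> with \<open>i \<le> j\<close> is matched with
  \<open>(Suc j, i)\<close>: the values of \<open>H\<close> agree and the exponents differ by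
  one.\<close>

lemma alternating_double_sum:
  assumes "\<And>i j. i \<le> j \<Longrightarrow> j < n \<Longrightarrow> H i j = H (Suc j) i"
  shows "(\<Sum>i<Suc n. \<Sum>j<n. frag_cmul ((- 1) ^ (i + j)) (H i j)) = 0"
proof -
  let ?f = "\<lambda>(i, j). frag_cmul ((- 1) ^ (i + j)) (H i j)"
  let ?P = "{(i, j). i \<le> j \<and> j < n}" and ?N = "{(i, j). j < i \<and> i < Suc n}"
  have fin: "finite ?P" "finite ?N"
    by (rule finite_subset[of _ "{..<Suc n} \<times> {..<Suc n}"]; auto)+
  have "(\<Sum>i<Suc n. \<Sum>j<n. frag_cmul ((- 1) ^ (i + j)) (H i j)) = sum ?f ({..<Suc n} \<times> {..<n})"
    by (rule sum.cartesian_product)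
  also have "{..<Suc n} \<times> {..<n} = ?P \<union> ?N" by auto
  also have "sum ?f (?P \<union> ?N) = sum ?f ?P + sum ?f ?N"
    by (rule sum.union_disjoint[OF fin]) auto
  also have "sum ?f ?N = (\<Sum>(i, j)\<in>?P. ?f (Suc j, i))"
    by (rule sum.reindex_bij_witness[of _ "\<lambda>(i, j). (Suc j, i)" "\<lambda>(i, j). (j, i - 1)"]) (auto elim!: less_natE)
  also have "\<dots> = (\<Sum>p\<in>?P. - ?f p)"
    using assms by (intro sum.cong) (auto simp: add.commute)
  finally show ?thesis by (simp add: sum_negf)
qed

text \<open>This is \<open>\<beta>\<close> of the twofold boundary of a singular cube of dimension
  \<open>Suc q\<close>. The cancellation is formal and precedes any knowledge that
  \<open>\<beta>\<close> commutes with boundaries, so it can serve inside the induction for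
  \<open>boundary_beta\<close>.\<close>

lemma singular_boundary_boundary:
  "(\<Sum>i<Suc q. frag_cmul ((- 1) ^ Suc i)
     (singular_boundary q (\<sigma> \<circ> vec_insert i 0) - singular_boundary q (\<sigma> \<circ> vec_insert i 1))) = 0"
proof (cases q)
  case 0
  then show ?thesis by (simp add: singular_boundary_def)
next
  case (Suc m)
  define F where "F i e j d = beta m (\<sigma> \<circ> vec_insert i e \<circ> vec_insert j d)" for i e j d
  \<comment> \<open>The four faces of codimension two in a pair of directions, with sign given by
    the number of upper ends.\<close>
  define H where "H i j = F i 0 j 0 - F i 0 j 1 - F i 1 j 0 + F i 1 j 1" for i j
  have "F i e j d = F (Suc j) d i e" if "i \<le> j" "j < q" for i j e d
    unfolding F_def using that Suc vec_insert_commute[of i j]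
    by (intro beta_cong) (simp add: unit_cube_iff)
  then have H: "H i j = H (Suc j) i" if "i \<le> j" "j < q" for i j
    using that by (simp add: H_def)
  have "frag_cmul ((- 1) ^ Suc i)
     (singular_boundary q (\<sigma> \<circ> vec_insert i 0) - singular_boundary q (\<sigma> \<circ> vec_insert i 1)) =
     (\<Sum>j<q. frag_cmul ((- 1) ^ (i + j)) (H i j))" for i
  proof -
    have "singular_boundary q (\<sigma> \<circ> vec_insert i 0) - singular_boundary q (\<sigma> \<circ> vec_insert i 1) =
      (\<Sum>j<q. frag_cmul ((- 1) ^ Suc j) (F i 0 j 0 - F i 0 j 1) -
              frag_cmul ((- 1) ^ Suc j) (F i 1 j 0 - F i 1 j 1))"
      by (simp only: singular_boundary_def F_def Suc diff_Suc_1 sum_subtractf)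
    also have "\<dots> = (\<Sum>j<q. frag_cmul ((- 1) ^ Suc j) (H i j))"
      by (intro sum.cong refl poly_mapping_eqI)
        (simp add: H_def lookup_minus lookup_add algebra_simps)
    finally show ?thesis
      by (simp add: frag_cmul_sum power_add)
  qed
  then show ?thesis using alternating_double_sum[of q H] H by simp
qed

section \<open>Vertices of cubical cycles\<close>

definition dirs :: "int vec set \<Rightarrow> nat set" where
  "dirs Q = set (nondeg_indices (factors Q))"

lemma dirs_cube:
  assumes "K \<subseteq> {..<dim_vec x}"
  shows "dirs (cube x K) = K"
proof -
  have "finite K" using assms finite_subset by blast
  then show ?thesis by (simp add: dirs_def factors_cube nondeg_indices_cube_factors[OF assms])
qed

text \<open>The part of a chain that crosses from \<open>a\<close> to \<open>a + 1\<close> in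
  direction \<open>k\<close>, with each cube replaced by its lower face. The sign counts the
  directions above \<open>k\<close>, as if \<open>k\<close> were moved to the last place: this makes
  the map commute with the boundary, whereas counting the directions below would make it
  anticommute.\<close>

definition slab :: "nat \<Rightarrow> int \<Rightarrow> (int vec set \<Rightarrow>\<^sub>0 int) \<Rightarrow> (int vec set \<Rightarrow>\<^sub>0 int)" where
  "slab k a = frag_extend (\<lambda>Q. if k \<in> dirs Q \<and> lex_min Q $ k = a
     then frag_cmul ((- 1) ^ card {j \<in> dirs Q. k < j}) (frag_of (cube (lex_min Q) (dirs Q - {k})))
     else 0)"

lemma slab_cube:
  assumes "K \<subseteq> {..<dim_vec x}"
  shows "slab k a (frag_of (cube x K)) = (if k \<in> K \<and> x $ k = a
     then frag_cmul ((- 1) ^ card {j \<in> K. k < j}) (frag_of (cube x (K - {k}))) else 0)"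
  using assms by (simp add: slab_def dirs_cube lex_min_cube)

lemma elementary_cubeE:
  assumes "elementary_cube q Q"
  obtains x K where "K \<subseteq> {..<dim_vec x}" "card K = q" "Q = cube x K" "finite K"
  using assms unfolding elementary_cube_iff by (metis finite_lessThan finite_subset)

lemma cube_chainE:
  assumes "Poly_Mapping.keys c \<subseteq> {Q. elementary_cube q Q}" "Q \<in> Poly_Mapping.keys c"
  obtains x K where "K \<subseteq> {..<dim_vec x}" "card K = q" "Q = cube x K" "finite K"
  using elementary_cubeE[of q Q] assms by blast

lemma elementary_cube_cube:
  "K \<subseteq> {..<dim_vec x} \<Longrightarrow> elementary_cube (card K) (cube x K)"
  unfolding elementary_cube_iff by blast

text \<open>If \<open>k < l\<close>, removing either index lowers the count attached to the other by
  one; if \<open>l < k\<close>, both counts stay the same.\<close>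

lemma slab_face_sign:
  assumes "finite K" "k \<in> K" "l \<in> K" "l \<noteq> k"
  shows "(- 1 :: int) ^ card {j \<in> K. k < j} * (- 1) ^ Suc (rank_in (K - {k}) l) =
    (- 1) ^ Suc (rank_in K l) * (- 1) ^ card {j \<in> K - {l}. k < j}"
proof (cases "k < l")
  case True
  have "{j \<in> K - {l}. k < j} = {j \<in> K. k < j} - {l}" by auto
  moreover have "card {j \<in> K. k < j} = Suc (card ({j \<in> K. k < j} - {l}))"
    using assms True by (intro card.remove) auto
  moreover have "rank_in K l = Suc (rank_in (K - {k}) l)"
    using rank_in_Diff[OF assms(1,2), of l] rank_in_strict_mono[OF assms(1,2) True] True by simp
  ultimately show ?thesis by simp
next
  case False
  then have "{j \<in> K - {l}. k < j} = {j \<in> K. k < j}" by auto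
  then show ?thesis using False rank_in_Diff[OF assms(1,2), of l] by simp
qed

lemma slab_diff: "slab k a (c - d) = slab k a c - slab k a d"
  and slab_cmul: "slab k a (frag_cmul m c) = frag_cmul m (slab k a c)"
  and slab_sum: "finite I \<Longrightarrow> slab k a (\<Sum>i\<in>I. f i) = (\<Sum>i\<in>I. slab k a (f i))"
  and slab_0 [simp]: "slab k a 0 = 0"
  by (simp_all add: slab_def frag_extend_diff frag_extend_cmul frag_extend_sum comp_def)

text \<open>A face in direction \<open>k\<close> no longer has this direction and is discarded. The
  other faces keep both the direction \<open>k\<close> and the position \<open>x $ k\<close>, and
  \<open>slab_face_sign\<close> matches the signs.\<close>

lemma slab_boundary:
  assumes "Poly_Mapping.keys c \<subseteq> {Q. elementary_cube q Q}"
  shows "slab k a (boundary c) = boundary (slab k a c)"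
  using assms
proof (induction c rule: frag_induction)
  case (one Q)
  then obtain x K where K: "K \<subseteq> {..<dim_vec x}" "Q = cube x K" "finite K"
    by (auto elim: elementary_cubeE)
  let ?G = "\<lambda>K l. frag_of (cube x (K - {l})) - frag_of (cube (shift x l 1) (K - {l}))"
  have faces: "slab k a (?G K l) = (if l \<noteq> k \<and> k \<in> K \<and> x $ k = a then
      frag_cmul ((- 1) ^ card {j \<in> K - {l}. k < j}) (?G (K - {k}) l) else 0)" if "l \<in> K" for l
  proof -
    have "K - {l} \<subseteq> {..<dim_vec x}" "K - {l} \<subseteq> {..<dim_vec (shift x l 1)}" using K(1) by auto
    moreover have "K - {l} - {k} = K - {k} - {l}" by auto
    ultimately have "slab k a (?G K l) = (if k \<in> K - {l} \<and> x $ k = a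
        then frag_cmul ((- 1) ^ card {j \<in> K - {l}. k < j}) (frag_of (cube x (K - {k} - {l}))) else 0)
      - (if k \<in> K - {l} \<and> shift x l 1 $ k = a
        then frag_cmul ((- 1) ^ card {j \<in> K - {l}. k < j}) (frag_of (cube (shift x l 1) (K - {k} - {l}))) else 0)"
      by (simp only: slab_diff slab_cube)
    moreover have "k \<in> K \<Longrightarrow> l \<noteq> k \<Longrightarrow> shift x l 1 $ k = x $ k" using K(1) by (auto simp: subset_iff)
    ultimately show ?thesis
      by (cases "k \<in> K"; cases "l = k") (simp_all add: frag_cmul_diff_right)
  qed
  have "slab k a (boundary (frag_of Q)) = (\<Sum>l\<in>K. frag_cmul ((- 1) ^ Suc (rank_in K l))
      (slab k a (?G K l)))"
    unfolding K(2) boundary_cube[OF K(1)] slab_sum[OF K(3)] slab_cmul ..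
  also have "\<dots> = boundary (slab k a (frag_of Q))"
  proof (cases "k \<in> K \<and> x $ k = a")
    case True
    have "(\<Sum>l\<in>K. frag_cmul ((- 1) ^ Suc (rank_in K l)) (slab k a (?G K l))) =
      (\<Sum>l\<in>K - {k}. frag_cmul ((- 1) ^ Suc (rank_in K l)) (slab k a (?G K l)))"
      using K(3) True faces by (intro sum.mono_neutral_right) auto
    also have "\<dots> = (\<Sum>l\<in>K - {k}. frag_cmul ((- 1) ^ card {j \<in> K. k < j})
      (frag_cmul ((- 1) ^ Suc (rank_in (K - {k}) l)) (?G (K - {k}) l)))"
    proof (rule sum.cong[OF refl])
      fix l assume "l \<in> K - {k}"
      then have l: "l \<in> K" "l \<noteq> k" by auto
      show "frag_cmul ((- 1) ^ Suc (rank_in K l)) (slab k a (?G K l)) =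
        frag_cmul ((- 1) ^ card {j \<in> K. k < j})
          (frag_cmul ((- 1) ^ Suc (rank_in (K - {k}) l)) (?G (K - {k}) l))"
        unfolding frag_cmul_cmul slab_face_sign[OF K(3) conjunct1[OF True] l] faces[OF l(1)]
        using True l by simp
    qed
    also have "\<dots> = frag_cmul ((- 1) ^ card {j \<in> K. k < j}) (boundary (frag_of (cube x (K - {k}))))"
      using K(1) by (subst boundary_cube) (auto simp: frag_cmul_sum)
    also have "\<dots> = boundary (slab k a (frag_of Q))"
      unfolding K(2) slab_cube[OF K(1)] using True by (simp add: boundary_cmul)
    finally show ?thesis .
  next
    case False
    then have "slab k a (frag_of Q) = 0" unfolding K(2) slab_cube[OF K(1)] by auto
    moreover have "(\<Sum>l\<in>K. frag_cmul ((- 1) ^ Suc (rank_in K l)) (slab k a (?G K l))) = 0"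
      using faces False by (intro sum.neutral) auto
    ultimately show ?thesis by simp
  qed
  finally show ?case .
qed (simp_all add: boundary_diff slab_diff)

lemma keys_slab:
  assumes "Poly_Mapping.keys c \<subseteq> {Q. elementary_cube q Q}" "R \<in> Poly_Mapping.keys (slab k a c)"
  obtains x K where "K \<subseteq> {..<dim_vec x}" "card K = q" "cube x K \<in> Poly_Mapping.keys c"
    "k \<in> K" "x $ k = a" "R = cube x (K - {k})"
proof -
  obtain Q where Q: "Q \<in> Poly_Mapping.keys c" "R \<in> Poly_Mapping.keys (slab k a (frag_of Q))"
    using assms(2) keys_frag_extend unfolding slab_def by (fastforce split: if_splits)
  obtain x K where K: "K \<subseteq> {..<dim_vec x}" "card K = q" "Q = cube x K"
    using cube_chainE[OF assms(1) Q(1)] by metis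
  show thesis
    using Q that[OF K(1,2)] unfolding K(3) slab_cube[OF K(1)] by (auto split: if_splits)
qed

text \<open>A cube of the slab is recovered from its lower face by adding the direction
  \<open>k\<close>. Distinct cubes therefore give distinct generators, and no coefficient can
  cancel.\<close>

lemma slab_nonzero:
  assumes c: "Poly_Mapping.keys c \<subseteq> {Q. elementary_cube q Q}"
    and K: "K \<subseteq> {..<dim_vec x}" "cube x K \<in> Poly_Mapping.keys c" "k \<in> K"
  shows "slab k (x $ k) c \<noteq> 0"
proof -
  let ?R = "cube x (K - {k})"
  have "Poly_Mapping.lookup (slab k (x $ k) c) ?R =
    (\<Sum>Q\<in>Poly_Mapping.keys c. Poly_Mapping.lookup c Q *
      Poly_Mapping.lookup (slab k (x $ k) (frag_of Q)) ?R)"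
    unfolding slab_def by (subst frag_extend_def) (simp add: lookup_sum)
  also have "\<dots> = (\<Sum>Q\<in>Poly_Mapping.keys c. if Q = cube x K then
      Poly_Mapping.lookup c Q * (- 1) ^ card {j \<in> K. k < j} else 0)"
  proof (rule sum.cong[OF refl])
    fix Q assume "Q \<in> Poly_Mapping.keys c"
    then obtain y L where L: "L \<subseteq> {..<dim_vec y}" "Q = cube y L"
      using cube_chainE[OF c] by metis
    have "y = x \<and> L = K" if "k \<in> L" "cube y (L - {k}) = ?R"
    proof -
      have "y = x \<and> L - {k} = K - {k}" using that(2) L K by (intro cube_inject) auto
      then show ?thesis using that(1) K(3) by blast
    qed
    then show "Poly_Mapping.lookup c Q * Poly_Mapping.lookup (slab k (x $ k) (frag_of Q)) ?R =
        (if Q = cube x K then Poly_Mapping.lookup c Q * (- 1) ^ card {j \<in> K. k < j} else 0)"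
      unfolding L(2) slab_cube[OF L(1)] using K(3) cube_inject[OF _ L(1) K(1)]
      by (auto simp: lookup_frag_cmul)
  qed
  also have "\<dots> \<noteq> 0" using K(2) by (simp add: sum.delta in_keys_iff)
  finally show ?thesis by auto
qed

text \<open>The sum of the coefficients, with the integers represented as the free abelian group on
  one generator so that the rules for \<open>frag_extend\<close> apply.\<close>

definition augment :: "('a \<Rightarrow>\<^sub>0 int) \<Rightarrow> (unit \<Rightarrow>\<^sub>0 int)" where
  "augment = frag_extend (\<lambda>_. frag_of ())"

text \<open>The number of signed edges of a 1-cycle crossing a hyperplane is zero: it is the total
  coefficient of the boundary on one side of that hyperplane.\<close>

lemma augment_slab:
  assumes "Poly_Mapping.keys c \<subseteq> {Q. elementary_cube 1 Q}" "boundary c = 0"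
  shows "augment (slab k a c) = 0"
proof -
  \<comment> \<open>Sums the coefficients on the lower side of the hyperplane. Chains may mix cubes
    of different ambient dimensions; the guard makes both ends of an edge without coordinate
    \<open>k\<close> count as zero.\<close>
  define half where "half = frag_extend (\<lambda>Q. if k < dim_vec (lex_min Q) \<and> lex_min Q $ k \<le> a
    then frag_of () else (0 :: unit \<Rightarrow>\<^sub>0 int))"
  have "half (boundary c) = - augment (slab k a c)"
    using assms(1)
  proof (induction c rule: frag_induction)
    case (one Q)
    then obtain x K where K: "K \<subseteq> {..<dim_vec x}" "Q = cube x K" "card K = 1"
      by (auto elim: elementary_cubeE)
    then obtain l where l: "K = {l}" "l < dim_vec x" by (auto simp: card_1_singleton_iff)
    have "boundary (frag_of Q) = - (frag_of (cube x {}) - frag_of (cube (shift x l 1) {}))"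
    proof -
      have "rank_in {l} l = 0" by (auto simp: rank_in_def card_eq_0_iff)
      then show ?thesis unfolding K(2) boundary_cube[OF K(1)] by (simp add: l(1))
    qed
    moreover have "slab k a (frag_of Q) = (if k = l \<and> x $ k = a then frag_of (cube x {}) else 0)"
    proof -
      have none: "{j. j = l \<and> l < j} = {}" by auto
      show ?thesis unfolding K(2) slab_cube[OF K(1)] by (auto simp: l(1) none)
    qed
    ultimately show ?case
      using l(2)
      by (auto simp: half_def augment_def frag_extend_diff frag_extend_minus lex_min_cube)
  qed (auto simp: half_def augment_def boundary_def slab_def frag_extend_diff)
  then show ?thesis using assms(2) by (simp add: half_def)
qed

lemma finite_cube: "K \<subseteq> {..<dim_vec x} \<Longrightarrow> finite (cube x K)"
  using param_image[of K x "card K"] by (metis finite_imageI finite_unit_cube)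

text \<open>A slab of a cycle in which a coordinate \<open>k\<close> is nondegenerate is a cycle of one
  dimension less, and each of its vertices occurs at both ends of the slab.\<close>

lemma card_vertices_cycle:
  assumes "Poly_Mapping.keys c \<subseteq> {Q. elementary_cube q Q}" "c \<noteq> 0"
    and "if q = 0 then augment c = 0 else boundary c = 0"
  shows "2 ^ Suc q \<le> card (\<Union>(Poly_Mapping.keys c))"
  using assms
proof (induction q arbitrary: c)
  case 0
  have points: "\<exists>x. Q = {x}" if Q: "Q \<in> Poly_Mapping.keys c" for Q
  proof -
    obtain x K where "card K = 0" "Q = cube x K" "finite K"
      using cube_chainE[OF 0(1) Q] by metis
    moreover have "cube x {} = {x}"
      by (auto simp: cube_def intro: carrier_vecI eq_vecI)
    ultimately show ?thesis by auto
  qed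
  have fin: "finite (\<Union>(Poly_Mapping.keys c))" using points by force
  show ?case
  proof (rule ccontr)
    assume "\<not> ?case"
    then have le: "card (\<Union>(Poly_Mapping.keys c)) \<le> 1" by simp
    obtain Q where Q: "Q \<in> Poly_Mapping.keys c" using 0(2) by (metis keys_eq_empty equals0I)
    have "R = Q" if "R \<in> Poly_Mapping.keys c" for R
      using points[OF that] points[OF Q] that Q le card_le_Suc0_iff_eq[OF fin] by fastforce
    \<comment> \<open>A single point carries the whole chain, so the augmentation is its nonzero
      coefficient.\<close>
    then have "Poly_Mapping.keys c = {Q}" using Q by blast
    then have "augment c = frag_cmul (Poly_Mapping.lookup c Q) (frag_of ())"
      by (simp add: augment_def frag_extend_def)
    then show False using 0(3) Q by (simp add: in_keys_iff)
  qed
next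
  case (Suc q)
  obtain Q where Q: "Q \<in> Poly_Mapping.keys c" using Suc.prems(2) by (metis keys_eq_empty equals0I)
  then obtain x K where K: "K \<subseteq> {..<dim_vec x}" "card K = Suc q" "Q = cube x K"
    using cube_chainE[OF Suc.prems(1)] by metis
  then obtain k where k: "k \<in> K" by fastforce
  let ?a = "x $ k"
  let ?c = "slab k ?a c"
  have nz: "?c \<noteq> 0" using slab_nonzero[OF Suc.prems(1) K(1) _ k] Q K(3) by simp
  note slabE = keys_slab[OF Suc.prems(1)]
  have keys: "Poly_Mapping.keys ?c \<subseteq> {Q. elementary_cube q Q}"
  proof
    fix R assume "R \<in> Poly_Mapping.keys ?c"
    then obtain y L where L: "L \<subseteq> {..<dim_vec y}" "card L = Suc q" "k \<in> L" "R = cube y (L - {k})"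
      by (rule slabE)
    then have "card (L - {k}) = q" by simp
    then show "R \<in> {Q. elementary_cube q Q}"
      using L elementary_cube_cube[of "L - {k}" y] by auto
  qed
  \<comment> \<open>The slab of a 1-cycle is a 0-chain, where the crossing count supplies the
    condition that the boundary cannot.\<close>
  have "if q = 0 then augment ?c = 0 else boundary ?c = 0"
    using augment_slab[of c k ?a] slab_boundary[OF Suc.prems(1), of k ?a] Suc.prems by auto
  from Suc.IH[OF keys nz this] have IH: "2 ^ Suc q \<le> card (\<Union>(Poly_Mapping.keys ?c))" .
  let ?V = "\<Union>(Poly_Mapping.keys ?c)" and ?W = "\<Union>(Poly_Mapping.keys c)"
  have finW: "finite ?W"
    using cube_chainE[OF Suc.prems(1)] finite_cube by (metis finite_Union finite_keys)
  have V: "y \<in> ?W \<and> shift y k 1 \<in> ?W \<and> k < dim_vec y \<and> y $ k = ?a" if y: "y \<in> ?V" for y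
  proof -
    obtain R where "R \<in> Poly_Mapping.keys ?c" "y \<in> R" using y by blast
    then obtain z L where L: "L \<subseteq> {..<dim_vec z}" "cube z L \<in> Poly_Mapping.keys c"
      "k \<in> L" "z $ k = ?a" "y \<in> cube z (L - {k})"
      by (metis slabE)
    have "k < dim_vec z" using L(1,3) by auto
    then have "y $ k = ?a" "k < dim_vec y" using cubeD(1)[OF L(5)] cubeD(2)[OF L(5), of k] L(4) by auto
    moreover have "y \<in> cube z L" using L(5) by (auto simp: cube_def)
    moreover have "shift y k 1 \<in> cube z L"
    proof -
      have "shift y k 1 $ i = z $ i \<or> i \<in> L \<and> shift y k 1 $ i = z $ i + 1"
        if i: "i < dim_vec z" for i
        using cubeD(1)[OF L(5)] cubeD(2)[OF L(5) i] L(3,4) \<open>y $ k = ?a\<close> i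
        by (cases "i = k") auto
      then show ?thesis
        using cubeD(1)[OF L(5)] unfolding cube_def by (auto intro!: carrier_vecI)
    qed
    ultimately show ?thesis using L(2) by blast
  qed
  have inj: "inj_on (\<lambda>y. shift y k 1) ?V"
  proof (rule inj_onI)
    fix y z assume yz: "shift y k 1 = shift z k 1"
    show "y = z"
    proof (rule eq_vecI)
      show d: "dim_vec y = dim_vec z" using arg_cong[OF yz, of dim_vec] by simp
      fix i assume "i < dim_vec z"
      then show "y $ i = z $ i"
        using arg_cong[OF yz, of "\<lambda>v. v $ i"] d by (simp split: if_splits)
    qed
  qed
  \<comment> \<open>Vertices of the slab have \<open>?a\<close> as coordinate \<open>k\<close>,
    their shifts have \<open>?a + 1\<close>.\<close>
  have "(\<lambda>y. shift y k 1) ` ?V \<inter> ?V = {}"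
  proof -
    have "shift y k 1 \<notin> ?V" if "y \<in> ?V" for y
      using V[OF that] V[of "shift y k 1"] by auto
    then show ?thesis by auto
  qed
  moreover have fV: "finite ?V" using finW V by (meson finite_subset subsetI)
  ultimately have "card ((\<lambda>y. shift y k 1) ` ?V \<union> ?V) = card ?V + card ?V"
    using card_image[OF inj] by (subst card_Un_disjoint) auto
  moreover have "card ((\<lambda>y. shift y k 1) ` ?V \<union> ?V) \<le> card ?W"
    using V by (intro card_mono[OF finW]) blast
  ultimately show ?case using IH by simp
qed

section \<open>The induced chain map\<close>

lemma continuous_mono:
  "c1_continuous X Y f \<Longrightarrow> Y \<subseteq> Z \<Longrightarrow> c1_continuous X Z f"
  unfolding c1_continuous_def by blast

lemma continuous_comp:
  assumes "c1_continuous X Y f" "c1_continuous Y Z g"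
  shows "c1_continuous X Z (g \<circ> f)"
  unfolding c1_continuous_def comp_def
  using c1_continuousD[OF assms(1)] c1_continuousD[OF assms(2)] by (metis Pi_I)

lemma continuous_param:
  assumes "K \<subseteq> {..<dim_vec x}" "card K = q"
  shows "c1_continuous (unit_cube q) (cube x K) (param x K)"
  unfolding c1_continuous_def
proof (intro conjI ballI impI)
  have fin: "finite K" using assms finite_subset by blast
  show "param x K \<in> unit_cube q \<rightarrow> cube x K" using param_image[OF assms] by blast
  fix s t assume st: "s \<in> unit_cube q" "t \<in> unit_cube q" "c1_adjacent s t"
  then obtain m e where m: "m < q" "\<bar>e\<bar> = 1"
    "\<And>j. j < q \<Longrightarrow> t $ j = s $ j + (if j = m then e else 0)"
    using unit_cubeD(1)[OF st(1)] unfolding c1_adjacent_iff by auto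
  let ?k = "sorted_list_of_set K ! m"
  have k: "?k \<in> K" "rank_in K ?k = m"
    using sorted_list_nth_mem[OF fin, of m] rank_in_nth[OF fin, of m] m(1) assms(2) by auto
  have "param x K t $ i = param x K s $ i + (if i = ?k then e else 0)" if "i < dim_vec x" for i
  proof (cases "i \<in> K")
    case True
    have "rank_in K i < q" using rank_in_less_card[OF fin True] assms(2) by simp
    moreover have "rank_in K i = m \<longleftrightarrow> i = ?k"
      using k nth_rank_in[OF fin True] by auto
    ultimately show ?thesis using that True m(3) by simp
  next
    case False
    then show ?thesis using that k(1) by auto
  qed
  moreover have "?k < dim_vec x" using k(1) assms(1) by auto
  ultimately show "param x K s = param x K t \<or> c1_adjacent (param x K s) (param x K t)"
    unfolding c1_adjacent_iff dim_param using m(2) by blast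
qed

lemma act_id: "t \<in> unit_cube q \<Longrightarrow> act (0\<^sub>v q) id t = t"
proof (rule eq_vecI)
  fix i assume t: "t \<in> unit_cube q" and "i < dim_vec t"
  then show "act (0\<^sub>v q) id t $ i = t $ i"
    using unit_cubeD(1)[OF t] unit_cubeD(2)[OF t, of i] by auto
qed simp

lemma zero_unit_cube: "0\<^sub>v q \<in> unit_cube q"
  by (simp add: unit_cube_iff)

lemma orient_sign_id: "orient_sign q (0\<^sub>v q) id = 1"
proof -
  have none: "{i. i < q \<and> (0\<^sub>v q :: int vec) $ i \<noteq> 0} = {}" by auto
  show ?thesis unfolding orient_sign_def none by (simp add: sign_id)
qed

lemma beta_param:
  assumes "K \<subseteq> {..<dim_vec x}" "card K = q"
  shows "beta q (param x K) = frag_of (cube x K)"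
  using beta_param_act(2)[OF assms permutes_id zero_unit_cube, of "param x K"]
  by (simp add: act_id orient_sign_id)

lemma keys_beta:
  assumes "c1_continuous (unit_cube q) (carrier_vec n) \<sigma>"
  shows "Poly_Mapping.keys (beta q \<sigma>) \<subseteq> {Q. elementary_cube q Q \<and> Q \<subseteq> \<sigma> ` unit_cube q}"
proof (cases "inj_on \<sigma> (unit_cube q)")
  case True
  obtain x K z \<pi> where p: "K \<subseteq> {..<dim_vec x}" "card K = q"
    "\<pi> permutes {..<q}" "z \<in> unit_cube q"
    "\<And>t. t \<in> unit_cube q \<Longrightarrow> \<sigma> t = param x K (act z \<pi> t)"
    by (rule injective_cube_param[OF assms True]) (rule that)
  have "\<sigma> ` unit_cube q = cube x K" by (rule param_act_image[OF p(1-3,5)])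
  then show ?thesis
    using elementary_cube_cube[OF p(1)] p(2) beta_param_act(2)[OF p]
    by (auto dest: subsetD[OF keys_cmul])
qed (simp add: beta_def)

text \<open>In dimension 0 the only symmetry is the identity, so every point counts with sign
  1.\<close>

lemma augment_beta:
  assumes "c1_continuous (unit_cube 0) (carrier_vec n) \<sigma>"
  shows "augment (beta 0 \<sigma>) = frag_of ()"
proof -
  have "unit_cube 0 = {0\<^sub>v 0}" by (auto simp: unit_cube_iff)
  then have inj: "inj_on \<sigma> (unit_cube 0)" by simp
  obtain x K z \<pi> where p: "K \<subseteq> {..<dim_vec x}" "card K = 0"
    "\<pi> permutes {..<0}" "z \<in> unit_cube 0"
    "\<And>t. t \<in> unit_cube 0 \<Longrightarrow> \<sigma> t = param x K (act z \<pi> t)"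
    by (rule injective_cube_param[OF assms inj]) (rule that)
  have "orient_sign 0 z \<pi> = 1" using p(3) by (simp add: orient_sign_def sign_id)
  moreover have "beta 0 \<sigma> = frag_cmul (orient_sign 0 z \<pi>) (frag_of (cube x K))"
    by (rule beta_param_act(2)[OF p])
  ultimately show ?thesis by (simp add: augment_def)
qed

lemma keys_cmul_diff:
  assumes "Poly_Mapping.keys a \<subseteq> S" "Poly_Mapping.keys b \<subseteq> S"
  shows "Poly_Mapping.keys (frag_cmul c (a - b)) \<subseteq> S"
  using assms keys_cmul[of c "a - b"] keys_diff[of a b] by blast

lemma keys_singular_boundary:
  assumes "c1_continuous (unit_cube (Suc q)) (carrier_vec n) \<sigma>"
  shows "Poly_Mapping.keys (singular_boundary (Suc q) \<sigma>)
    \<subseteq> {Q. elementary_cube q Q \<and> Q \<subseteq> \<sigma> ` unit_cube (Suc q)}"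
proof -
  have face: "Poly_Mapping.keys (beta q (\<sigma> \<circ> vec_insert i e))
    \<subseteq> {Q. elementary_cube q Q \<and> Q \<subseteq> \<sigma> ` unit_cube (Suc q)}"
    if "i < Suc q" "e = 0 \<or> e = 1" for i e
  proof -
    have "vec_insert i e ` unit_cube q \<subseteq> unit_cube (Suc q)"
      using vec_insert_unit_cube[of _ q i e] that by (simp add: image_subset_iff)
    then have "(\<sigma> \<circ> vec_insert i e) ` unit_cube q \<subseteq> \<sigma> ` unit_cube (Suc q)"
      unfolding image_comp[symmetric] by (rule image_mono)
    moreover have "c1_continuous (unit_cube q) (carrier_vec n) (\<sigma> \<circ> vec_insert i e)"
      using continuous_vec_insert[OF assms] that by simp
    ultimately show ?thesis using keys_beta[of q n "\<sigma> \<circ> vec_insert i e"] by (simp add: subset_iff)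
  qed
  have "singular_boundary (Suc q) \<sigma> \<in> carrier (free_Abelian_group
      {Q. elementary_cube q Q \<and> Q \<subseteq> \<sigma> ` unit_cube (Suc q)})"
    unfolding singular_boundary_def diff_Suc_1
  proof (rule sum_closed_free_Abelian_group)
    fix i assume "i \<in> {..<Suc q}"
    then have i: "i < Suc q" by simp
    show "frag_cmul ((- 1) ^ Suc i) (beta q (\<sigma> \<circ> vec_insert i 0) - beta q (\<sigma> \<circ> vec_insert i 1))
        \<in> carrier (free_Abelian_group {Q. elementary_cube q Q \<and> Q \<subseteq> \<sigma> ` unit_cube (Suc q)})"
      unfolding carrier_free_Abelian_group_iff
      by (rule keys_cmul_diff[OF face[OF i] face[OF i]]) simp_all
  qed
  then show ?thesis by simp
qed

text \<open>If \<open>\<sigma>\<close> is not injective, the left side is zero and the claim is that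
  its faces cancel. The induction hypothesis is applied to these faces, any of which may or may not
  be injective, so the statement has to cover all continuous cubes at once.\<close>

lemma boundary_beta:
  assumes "c1_continuous (unit_cube q) (carrier_vec n) \<sigma>"
  shows "boundary (beta q \<sigma>) = singular_boundary q \<sigma>"
  using assms
proof (induction q arbitrary: \<sigma>)
  case 0
  have "unit_cube 0 = {0\<^sub>v 0}" by (auto simp: unit_cube_iff)
  then have inj: "inj_on \<sigma> (unit_cube 0)" by simp
  show ?case
    by (rule injective_cube_param[OF 0 inj]) (rule boundary_beta_param_act)
next
  case (Suc q)
  show ?case
  proof (cases "inj_on \<sigma> (unit_cube (Suc q))")
    case True
    show ?thesis
      by (rule injective_cube_param[OF Suc.prems True]) (rule boundary_beta_param_act)
  next
    case False
    let ?D = "singular_boundary (Suc q) \<sigma>"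
    note cont = continuous_vec_insert[OF Suc.prems]
    \<comment> \<open>For \<open>q = 0\<close> both endpoints have augmentation 1 and enter with
      opposite signs. Otherwise the induction hypothesis for the faces turns the boundary into a
      twofold singular boundary.\<close>
    have cycle: "if q = 0 then augment ?D = 0 else boundary ?D = 0"
    proof (cases "q = 0")
      case True
      have "augment ?D = 0"
        using augment_beta[of n "\<sigma> \<circ> vec_insert 0 0"] augment_beta[of n "\<sigma> \<circ> vec_insert 0 1"]
          cont[of 0 0] cont[of 0 1] True
        by (simp add: singular_boundary_def augment_def frag_extend_diff frag_extend_cmul
            frag_extend_minus)
      then show ?thesis using True by simp
    next
      case False
      have "boundary ?D = (\<Sum>i<Suc q. frag_cmul ((- 1) ^ Suc i)
          (boundary (beta q (\<sigma> \<circ> vec_insert i 0)) - boundary (beta q (\<sigma> \<circ> vec_insert i 1))))"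
        unfolding singular_boundary_def diff_Suc_1
        by (simp only: boundary_sum finite_lessThan boundary_cmul boundary_diff)
      also have "\<dots> = (\<Sum>i<Suc q. frag_cmul ((- 1) ^ Suc i)
          (singular_boundary q (\<sigma> \<circ> vec_insert i 0) - singular_boundary q (\<sigma> \<circ> vec_insert i 1)))"
      proof (intro sum.cong refl)
        fix i assume "i \<in> {..<Suc q}"
        then have i: "i \<le> q" by simp
        have IH: "boundary (beta q (\<sigma> \<circ> vec_insert i e)) = singular_boundary q (\<sigma> \<circ> vec_insert i e)"
          if "e = 0 \<or> e = 1" for e
          by (rule Suc.IH[OF cont[OF i that]])
        show "frag_cmul ((- 1) ^ Suc i)
            (boundary (beta q (\<sigma> \<circ> vec_insert i 0)) - boundary (beta q (\<sigma> \<circ> vec_insert i 1))) =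
          frag_cmul ((- 1) ^ Suc i)
            (singular_boundary q (\<sigma> \<circ> vec_insert i 0) - singular_boundary q (\<sigma> \<circ> vec_insert i 1))"
          by (simp only: IH simp_thms)
      qed
      finally show ?thesis using False by (simp only: singular_boundary_boundary if_False)
    qed
    have "?D = 0"
    proof (rule ccontr)
      assume "?D \<noteq> 0"
      have keys: "Poly_Mapping.keys ?D \<subseteq> {Q. elementary_cube q Q \<and> Q \<subseteq> \<sigma> ` unit_cube (Suc q)}"
        by (rule keys_singular_boundary[OF Suc.prems])
      then have "2 ^ Suc q \<le> card (\<Union>(Poly_Mapping.keys ?D))"
        using \<open>?D \<noteq> 0\<close> cycle by (intro card_vertices_cycle) auto
      also have "\<dots> \<le> card (\<sigma> ` unit_cube (Suc q))"
        using keys by (intro card_mono) auto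
      \<comment> \<open>Two vertices with the same image make the inequality strict.\<close>
      also have "\<dots> < card (unit_cube (Suc q))"
        using False by (metis card_image_le eq_card_imp_inj_on finite_unit_cube le_neq_implies_less)
      finally show False by (simp add: card_unit_cube)
    qed
    moreover have "beta (Suc q) \<sigma> = 0" using False by (simp add: beta_def)
    ultimately show ?thesis by simp
  qed
qed

section \<open>The boundary squares to zero\<close>

lemma boundary_cube_singular:
  assumes "K \<subseteq> {..<dim_vec x}" "card K = q"
  shows "boundary (frag_of (cube x K)) = singular_boundary q (param x K)"
  using boundary_beta_param_act[OF assms permutes_id zero_unit_cube, of "param x K"]
  by (simp add: act_id beta_param[OF assms])

text \<open>The faces of a standard parametrization are continuous cubes, so
  \<open>boundary_beta\<close> reduces the claim to the formal cancellation in
  \<open>singular_boundary_boundary\<close>.\<close>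

lemma boundary_boundary:
  assumes "Poly_Mapping.keys c \<subseteq> {Q. elementary_cube q Q}"
  shows "boundary (boundary c) = 0"
  using assms
proof (induction c rule: frag_induction)
  case (one Q)
  then obtain x K where K: "K \<subseteq> {..<dim_vec x}" "card K = q" "Q = cube x K"
    by (auto elim: elementary_cubeE)
  show ?case
  proof (cases q)
    case 0
    then show ?thesis unfolding K(3) boundary_cube_singular[OF K(1,2)]
      by (simp add: singular_boundary_def)
  next
    case (Suc m)
    have "cube x K \<subseteq> carrier_vec (dim_vec x)" by (auto simp: cube_def)
    then have "c1_continuous (unit_cube (Suc m)) (carrier_vec (dim_vec x)) (param x K)"
      using continuous_param[OF K(1)] K(2) Suc by (auto intro: continuous_mono)
    note cont = continuous_vec_insert[OF this]
    have "boundary (boundary (frag_of Q)) = (\<Sum>i<Suc m. frag_cmul ((- 1) ^ Suc i)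
        (boundary (beta m (param x K \<circ> vec_insert i 0)) - boundary (beta m (param x K \<circ> vec_insert i 1))))"
      unfolding K(3) boundary_cube_singular[OF K(1,2)] unfolding singular_boundary_def Suc diff_Suc_1
      by (simp only: boundary_sum finite_lessThan boundary_cmul boundary_diff)
    also have "\<dots> = (\<Sum>i<Suc m. frag_cmul ((- 1) ^ Suc i)
        (singular_boundary m (param x K \<circ> vec_insert i 0) - singular_boundary m (param x K \<circ> vec_insert i 1)))"
    proof (intro sum.cong refl)
      fix i assume "i \<in> {..<Suc m}"
      then have i: "i \<le> m" by simp
      have face: "boundary (beta m (param x K \<circ> vec_insert i e)) =
          singular_boundary m (param x K \<circ> vec_insert i e)" if "e = 0 \<or> e = 1" for e
        by (rule boundary_beta[OF cont[OF i that]])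
      show "frag_cmul ((- 1) ^ Suc i) (boundary (beta m (param x K \<circ> vec_insert i 0)) -
          boundary (beta m (param x K \<circ> vec_insert i 1))) =
        frag_cmul ((- 1) ^ Suc i) (singular_boundary m (param x K \<circ> vec_insert i 0) -
          singular_boundary m (param x K \<circ> vec_insert i 1))"
        by (simp only: face simp_thms)
    qed
    also have "\<dots> = 0" by (rule singular_boundary_boundary)
    finally show ?thesis .
  qed
qed (simp_all add: boundary_diff)

section \<open>The induced map on chains commutes with the boundary\<close>

lemma chain_map_cube:
  assumes "K \<subseteq> {..<dim_vec x}" "card K = q"
  shows "chain_map q f (frag_of (cube x K)) = beta q (f \<circ> param x K)"
  unfolding chain_map_def frag_extend_of
  using assms by (intro beta_cong) (simp add: cube_param_eq unit_cubeD(1))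

lemma chain_map_0 [simp]: "chain_map q f 0 = 0"
  and chain_map_diff: "chain_map q f (c - d) = chain_map q f c - chain_map q f d"
  and chain_map_add: "chain_map q f (c + d) = chain_map q f c + chain_map q f d"
  and chain_map_minus: "chain_map q f (- c) = - chain_map q f c"
  and chain_map_cmul: "chain_map q f (frag_cmul m c) = frag_cmul m (chain_map q f c)"
  and chain_map_sum: "finite I \<Longrightarrow> chain_map q f (\<Sum>i\<in>I. h i) = (\<Sum>i\<in>I. chain_map q f (h i))"
  by (simp_all add: chain_map_def frag_extend_cmul frag_extend_diff frag_extend_add
      frag_extend_minus frag_extend_sum comp_def)

lemma carrier_chain_group:
  "c \<in> carrier (chain_group q X) \<longleftrightarrow> Poly_Mapping.keys c \<subseteq> {Q. elementary_cube q Q \<and> Q \<subseteq> X}"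
  by (simp add: chain_group_def)

lemma continuous_comp_param:
  assumes "c1_continuous X Y f" "K \<subseteq> {..<dim_vec x}" "card K = q" "cube x K \<subseteq> X"
  shows "c1_continuous (unit_cube q) Y (f \<circ> param x K)"
  using continuous_comp[OF continuous_mono[OF continuous_param[OF assms(2,3)] assms(4)] assms(1)] .

lemma chain_map_closed:
  assumes f: "c1_continuous X Y f" and Y: "Y \<subseteq> carrier_vec n"
    and c: "c \<in> carrier (chain_group q X)"
  shows "chain_map q f c \<in> carrier (chain_group q Y)"
proof -
  have "Poly_Mapping.keys (chain_map q f (frag_of Q)) \<subseteq> {Q. elementary_cube q Q \<and> Q \<subseteq> Y}"
    if "Q \<in> Poly_Mapping.keys c" for Q
  proof -
    obtain x K where K: "K \<subseteq> {..<dim_vec x}" "card K = q" "Q = cube x K" "cube x K \<subseteq> X"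
      using c \<open>Q \<in> Poly_Mapping.keys c\<close> elementary_cube_iff
      unfolding carrier_chain_group by (metis (mono_tags, lifting) mem_Collect_eq subsetD)
    note cont = continuous_comp_param[OF f K(1,2,4)]
    have "(f \<circ> param x K) ` unit_cube q \<subseteq> Y"
      using c1_continuousD(1)[OF cont] by (rule image_subsetI)
    then show ?thesis
      unfolding K(3) chain_map_cube[OF K(1,2)]
      using keys_beta[OF continuous_mono[OF cont Y]] by blast
  qed
  then show ?thesis
    unfolding carrier_chain_group
    using keys_frag_extend[of "\<lambda>Q. chain_map q f (frag_of Q)" c]
    by (simp add: chain_map_def) blast
qed

text \<open>Differences generate the chain group from its cubes, so linear statements about chains
  need a check only on parametrized cubes.\<close>

lemma chain_cube_induct [consumes 1, case_names zero cube diff]: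
  assumes "c \<in> carrier (chain_group q X)" "P 0"
    and "\<And>x K. K \<subseteq> {..<dim_vec x} \<Longrightarrow> card K = q \<Longrightarrow> cube x K \<subseteq> X \<Longrightarrow> P (frag_of (cube x K))"
    and "\<And>c d. P c \<Longrightarrow> P d \<Longrightarrow> P (c - d)"
  shows "P c"
  using assms(1) unfolding carrier_chain_group
  by (induction c rule: frag_induction) (use assms(2-4) in \<open>auto simp: elementary_cube_iff\<close>)

text \<open>By \<open>boundary_beta\<close> the left side is computed on the faces of
  \<open>f \<circ> param x K\<close>. Faces of a standard parametrization are the standard
  parametrizations of the faces, so no further sign appears.\<close>

lemma boundary_chain_map:
  assumes f: "c1_continuous X Y f" and Y: "Y \<subseteq> carrier_vec n"
    and c: "c \<in> carrier (chain_group (Suc q) X)"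
  shows "boundary (chain_map (Suc q) f c) = chain_map q f (boundary c)"
  using c
proof (induction c rule: chain_cube_induct)
  case (cube x K)
  have fin: "finite K" using cube(1) finite_subset by blast
  let ?F = "\<lambda>i. frag_cmul ((- 1) ^ Suc i)
     (beta q (f \<circ> param x K \<circ> vec_insert i 0) - beta q (f \<circ> param x K \<circ> vec_insert i 1))"
  let ?G = "\<lambda>k. frag_cmul ((- 1) ^ Suc (rank_in K k))
    (frag_of (cube x (K - {k})) - frag_of (cube (shift x k 1) (K - {k})))"
  have "boundary (chain_map (Suc q) f (frag_of (cube x K))) = (\<Sum>i<Suc q. ?F i)"
    unfolding chain_map_cube[OF cube(1,2)]
      boundary_beta[OF continuous_mono[OF continuous_comp_param[OF f cube] Y]]
    by (simp add: singular_boundary_def)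
  also have "\<dots> = (\<Sum>k\<in>K. ?F (rank_in K k))"
    using sum.reindex_bij_betw[OF bij_betw_rank_in[OF fin], of ?F] cube(2) by simp
  also have "\<dots> = (\<Sum>k\<in>K. chain_map q f (?G k))"
  proof (rule sum.cong[OF refl])
    fix k assume k: "k \<in> K"
    have K': "K - {k} \<subseteq> {..<dim_vec (shift x k e)}" "card (K - {k}) = q" for e
      using cube(1,2) k fin by auto
    have "beta q (f \<circ> param x K \<circ> vec_insert (rank_in K k) e) =
        chain_map q f (frag_of (cube (shift x k e) (K - {k})))" for e
      unfolding chain_map_cube[OF K'(1)[of e] K'(2)]
      by (rule beta_cong) (simp add: param_face[OF cube(1) k] cube(2) unit_cubeD(1))
    from this[of 0] this[of 1] show "?F (rank_in K k) = chain_map q f (?G k)"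
      by (simp add: chain_map_cmul chain_map_diff chain_map_minus)
  qed
  also have "\<dots> = chain_map q f (boundary (frag_of (cube x K)))"
    unfolding boundary_cube[OF cube(1)] chain_map_sum[OF fin] ..
  finally show ?case .
qed (simp_all add: chain_map_diff boundary_diff)

lemma boundary_closed:
  assumes "c \<in> carrier (chain_group (Suc q) X)"
  shows "boundary c \<in> carrier (chain_group q X)"
  using assms
proof (induction c rule: chain_cube_induct)
  case (cube x K)
  have fin: "finite K" using cube(1) finite_subset by blast
  have face: "elementary_cube q (cube (shift x k e) (K - {k})) \<and> cube (shift x k e) (K - {k}) \<subseteq> X"
    if k: "k \<in> K" and e: "e = 0 \<or> e = 1" for k e
  proof
    show "elementary_cube q (cube (shift x k e) (K - {k}))"
      using elementary_cube_cube[of "K - {k}" "shift x k e"] cube(1,2) fin k by auto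
    have "cube (shift x k e) (K - {k}) \<subseteq> cube x K"
    proof
      fix y assume y: "y \<in> cube (shift x k e) (K - {k})"
      have "y $ i = x $ i \<or> i \<in> K \<and> y $ i = x $ i + 1" if i: "i < dim_vec x" for i
        using cubeD(2)[OF y, of i] i k e by (cases "i = k") auto
      then show "y \<in> cube x K"
        using cubeD(1)[OF y] unfolding cube_def by (auto intro!: carrier_vecI)
    qed
    then show "cube (shift x k e) (K - {k}) \<subseteq> X" using cube(3) by blast
  qed
  show ?case
    unfolding boundary_cube[OF cube(1)] chain_group_def
  proof (rule sum_closed_free_Abelian_group)
    fix k assume "k \<in> K"
    note k = this
    show "frag_cmul ((- 1) ^ Suc (rank_in K k))
         (frag_of (cube x (K - {k})) - frag_of (cube (shift x k 1) (K - {k})))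
         \<in> carrier (free_Abelian_group {Q. elementary_cube q Q \<and> Q \<subseteq> X})"
      unfolding carrier_free_Abelian_group_iff
      using face[OF k, of 0] face[OF k, of 1] by (intro keys_cmul_diff) simp_all
  qed
next
  case (diff c d)
  then show ?case
    using keys_diff[of "boundary c" "boundary d"]
    unfolding carrier_chain_group boundary_diff by blast
qed (simp add: carrier_chain_group)

section \<open>Multiplicativity of the orientation and composition of chain maps\<close>

lemma sign_flips_prod:
  "(- 1 :: int) ^ card {i. i < q \<and> z $ i \<noteq> 0} = (\<Prod>i<q. if z $ i = 0 then 1 else - 1)"
proof -
  have "(\<Prod>i<q. if z $ i = 0 then 1 else - 1 :: int) = (\<Prod>i\<in>{..<q} \<inter> {i. z $ i \<noteq> 0}. - 1)"
    by (subst prod.inter_restrict) (auto intro!: prod.cong)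
  also have "{..<q} \<inter> {i. z $ i \<noteq> 0} = {i. i < q \<and> z $ i \<noteq> 0}" by auto
  finally show ?thesis by simp
qed

text \<open>The sign of a flip vector is a product over coordinates. Flips add modulo 2, so their
  signs multiply, and \<open>\<pi>\<close> merely reorders the factors that come from
  \<open>w\<close>.\<close>

lemma orient_sign_act:
  assumes "\<pi> permutes {..<q}" "\<rho> permutes {..<q}" "z \<in> unit_cube q" "w \<in> unit_cube q"
  shows "orient_sign q (act z \<pi> w) (\<rho> \<circ> \<pi>) = orient_sign q z \<pi> * orient_sign q w \<rho>"
proof -
  let ?s = "\<lambda>a. if a = 0 then 1 else - 1 :: int"
  have in_q: "\<pi> i < q" if "i < q" for i using permutes_in_image[OF assms(1)] that by simp
  have "(\<Prod>i<q. ?s (act z \<pi> w $ i)) = (\<Prod>i<q. ?s (z $ i) * ?s (w $ \<pi> i))"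
  proof (rule prod.cong[OF refl])
    fix i assume "i \<in> {..<q}"
    then have i: "i < q" by simp
    show "?s (act z \<pi> w $ i) = ?s (z $ i) * ?s (w $ \<pi> i)"
      using i unit_cubeD(1)[OF assms(4)] unit_cubeD(2)[OF assms(3) i]
        unit_cubeD(2)[OF assms(4) in_q[OF i]] by auto
  qed
  also have "\<dots> = (\<Prod>i<q. ?s (z $ i)) * (\<Prod>i<q. ?s (w $ i))"
    using prod.reindex_bij_betw[OF permutes_imp_bij[OF assms(1)], of "\<lambda>i. ?s (w $ i)"]
    by (simp add: prod.distrib)
  finally have "(\<Prod>i<q. ?s (act z \<pi> w $ i)) = (\<Prod>i<q. ?s (z $ i)) * (\<Prod>i<q. ?s (w $ i))" .
  moreover have "sign (\<rho> \<circ> \<pi>) = sign \<rho> * sign \<pi>"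
    using assms by (intro sign_compose permutes_imp_permutation[of "{..<q}"]) auto
  ultimately show ?thesis
    by (simp only: orient_sign_def sign_flips_prod) (simp add: mult_ac)
qed

text \<open>Place \<open>i\<close> outside reads place \<open>\<pi> i\<close> inside, which reads
  \<open>\<rho> (\<pi> i)\<close>; hence the permutations compose in reverse order.\<close>

lemma act_act:
  assumes "\<pi> permutes {..<q}" "dim_vec t = q" "dim_vec w = q"
  shows "act z \<pi> (act w \<rho> t) = act (act z \<pi> w) (\<rho> \<circ> \<pi>) t"
proof (rule eq_vecI)
  fix i assume "i < dim_vec (act (act z \<pi> w) (\<rho> \<circ> \<pi>) t)"
  then have i: "i < q" using assms(2) by simp
  then have "\<pi> i < q" using permutes_in_image[OF assms(1)] by simp
  then show "act z \<pi> (act w \<rho> t) $ i = act (act z \<pi> w) (\<rho> \<circ> \<pi>) t $ i"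
    using i assms(2,3) by (simp add: mod_simps add.assoc)
qed simp

text \<open>A symmetry of the unit cube preserves the image of a singular cube and whether it is
  injective; only the orientation changes, by the sign of the symmetry.\<close>

lemma beta_act:
  assumes cont: "c1_continuous (unit_cube q) (carrier_vec n) \<tau>"
    and \<rho>: "\<rho> permutes {..<q}" and w: "w \<in> unit_cube q"
    and \<sigma>: "\<And>t. t \<in> unit_cube q \<Longrightarrow> \<sigma> t = \<tau> (act w \<rho> t)"
  shows "beta q \<sigma> = frag_cmul (orient_sign q w \<rho>) (beta q \<tau>)"
proof (cases "inj_on \<tau> (unit_cube q)")
  case True
  obtain x K z \<pi> where p: "K \<subseteq> {..<dim_vec x}" "card K = q"
    "\<pi> permutes {..<q}" "z \<in> unit_cube q"
    "\<And>t. t \<in> unit_cube q \<Longrightarrow> \<tau> t = param x K (act z \<pi> t)"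
    by (rule injective_cube_param[OF cont True]) (rule that)
  have "\<sigma> t = param x K (act (act z \<pi> w) (\<rho> \<circ> \<pi>) t)" if t: "t \<in> unit_cube q" for t
    using \<sigma>[OF t] p(5)[OF act_unit_cube[OF t]] act_act[OF p(3) unit_cubeD(1)[OF t] unit_cubeD(1)[OF w]]
    by simp
  then have "beta q \<sigma> = frag_cmul (orient_sign q (act z \<pi> w) (\<rho> \<circ> \<pi>)) (frag_of (cube x K))"
    by (intro beta_param_act(2)[OF p(1,2) permutes_compose[OF p(3) \<rho>] act_unit_cube[OF w]])
  moreover have "beta q \<tau> = frag_cmul (orient_sign q z \<pi>) (frag_of (cube x K))"
    by (rule beta_param_act(2)[OF p])
  ultimately show ?thesis
    unfolding orient_sign_act[OF p(3) \<rho> p(4) w] by (simp add: mult.commute)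
next
  case False
  have "\<not> inj_on \<sigma> (unit_cube q)"
  proof
    assume "inj_on \<sigma> (unit_cube q)"
    then have "inj_on (\<tau> \<circ> act w \<rho>) (unit_cube q)"
      using \<sigma> by (subst inj_on_cong[of _ _ \<sigma>]) auto
    then have "inj_on \<tau> (act w \<rho> ` unit_cube q)" by (rule inj_on_imageI)
    then show False using False by (simp add: act_image[OF \<rho>])
  qed
  then show ?thesis using False by (simp add: beta_def)
qed

text \<open>When \<open>f \<circ> param x K\<close> is injective, it is the standard parametrization
  of its image only up to a symmetry. The sign of that symmetry enters the right side through
  \<open>chain_map q f\<close> and the left side through \<open>beta_act\<close>.\<close>

lemma chain_map_comp:
  assumes f: "c1_continuous X Y f" and g: "c1_continuous Y Z g"
    and YZ: "Y \<subseteq> carrier_vec m" "Z \<subseteq> carrier_vec n"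
    and c: "c \<in> carrier (chain_group q X)"
  shows "chain_map q (compose X g f) c = chain_map q g (chain_map q f c)"
  using c
proof (induction c rule: chain_cube_induct)
  case (cube x K)
  note cont = continuous_comp_param[OF f cube]
  have img: "param x K t \<in> X" if "t \<in> unit_cube q" for t
    using cube param_image[OF cube(1,2)] that by blast
  have comp: "chain_map q (compose X g f) (frag_of (cube x K)) = beta q (g \<circ> (f \<circ> param x K))"
    unfolding chain_map_cube[OF cube(1,2)] by (rule beta_cong) (simp add: compose_def img)
  show ?case
  proof (cases "inj_on (f \<circ> param x K) (unit_cube q)")
    case True
    obtain y L z \<pi> where p: "L \<subseteq> {..<dim_vec y}" "card L = q"
      "\<pi> permutes {..<q}" "z \<in> unit_cube q"
      "\<And>t. t \<in> unit_cube q \<Longrightarrow> (f \<circ> param x K) t = param y L (act z \<pi> t)"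
      by (rule injective_cube_param[OF continuous_mono[OF cont YZ(1)] True]) (rule that)
    have "cube y L = (f \<circ> param x K) ` unit_cube q" using param_act_image[OF p(1-3,5)] by simp
    then have "cube y L \<subseteq> Y"
      using c1_continuousD(1)[OF cont] by (simp only: image_subsetI)
    note cont' = continuous_mono[OF continuous_comp_param[OF g p(1,2) this] YZ(2)]
    have "beta q (g \<circ> (f \<circ> param x K)) = frag_cmul (orient_sign q z \<pi>) (beta q (g \<circ> param y L))"
      by (rule beta_act[OF cont' p(3,4)]) (use p(5) in simp)
    moreover have "beta q (f \<circ> param x K) = frag_cmul (orient_sign q z \<pi>) (frag_of (cube y L))"
      by (rule beta_param_act(2)[OF p])
    ultimately show ?thesis
      unfolding comp by (simp only: chain_map_cube[OF cube(1,2)] chain_map_cmul chain_map_cube[OF p(1,2)])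
  next
    case False
    \<comment> \<open>Vertices identified by \<open>f\<close> stay identified after
      \<open>g\<close>, so both sides vanish.\<close>
    then have "\<not> inj_on (g \<circ> (f \<circ> param x K)) (unit_cube q)" by (metis inj_on_imageI2)
    then show ?thesis
      unfolding comp unfolding chain_map_cube[OF cube(1,2)] using False by (simp add: beta_def)
  qed
qed (simp_all add: chain_map_diff)

lemma chain_map_id:
  assumes "c \<in> carrier (chain_group q X)"
  shows "chain_map q (\<lambda>x\<in>X. x) c = c"
  using assms
proof (induction c rule: chain_cube_induct)
  case (cube x K)
  have "beta q ((\<lambda>x\<in>X. x) \<circ> param x K) = beta q (param x K)"
    using param_image[OF cube(1,2)] cube(3) by (intro beta_cong) auto
  then show ?case unfolding chain_map_cube[OF cube(1,2)] beta_param[OF cube(1,2)] .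
qed (simp_all add: chain_map_diff)

section \<open>Homology\<close>

lemma comm_group_chain_group: "comm_group (chain_group q X)"
  unfolding chain_group_def by (rule abelian_free_Abelian_group)

lemma mult_chain_group [simp]: "c \<otimes>\<^bsub>chain_group q X\<^esub> d = c + d"
  by (simp add: chain_group_def)

lemma chain_subgroupI:
  assumes "S \<subseteq> carrier (chain_group q X)" "0 \<in> S"
    "\<And>c d. c \<in> S \<Longrightarrow> d \<in> S \<Longrightarrow> c + d \<in> S" "\<And>c. c \<in> S \<Longrightarrow> - c \<in> S"
  shows "subgroup S (chain_group q X)"
proof (rule group.subgroupI)
  show "group (chain_group q X)" by (simp add: chain_group_def)
  show "inv\<^bsub>chain_group q X\<^esub> c \<in> S" if "c \<in> S" for c
    using assms(1,4) that by (auto simp: chain_group_def)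
qed (use assms in auto)

lemma subgroup_cycles: "subgroup (cycles q X) (chain_group q X)"
proof (rule chain_subgroupI)
  fix c d assume "c \<in> cycles q X" "d \<in> cycles q X"
  then show "c + d \<in> cycles q X"
    using keys_add[of c d] by (auto simp: cycles_def boundary_add carrier_chain_group)
qed (auto simp: cycles_def boundary_minus carrier_chain_group)

lemma boundaries_subset_cycles: "boundaries q X \<subseteq> cycles q X"
proof
  fix b assume "b \<in> boundaries q X"
  then obtain c where c: "c \<in> carrier (chain_group (Suc q) X)" "b = boundary c"
    by (auto simp: boundaries_def)
  have "Poly_Mapping.keys c \<subseteq> {Q. elementary_cube (Suc q) Q}"
    using c(1) by (auto simp: carrier_chain_group)
  then show "b \<in> cycles q X"
    using boundary_closed[OF c(1)] boundary_boundary c(2) by (simp add: cycles_def)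
qed

lemma subgroup_boundaries: "subgroup (boundaries q X) (chain_group q X)"
proof (rule chain_subgroupI)
  show "boundaries q X \<subseteq> carrier (chain_group q X)"
    using boundaries_subset_cycles by (auto simp: cycles_def)
  show "0 \<in> boundaries q X"
    unfolding boundaries_def by (rule image_eqI[of _ _ 0]) (auto simp: carrier_chain_group)
  fix b assume "b \<in> boundaries q X"
  then obtain c where c: "c \<in> carrier (chain_group (Suc q) X)" "b = boundary c"
    by (auto simp: boundaries_def)
  show "- b \<in> boundaries q X"
    unfolding boundaries_def using c
    by (intro image_eqI[of _ _ "- c"]) (auto simp: boundary_minus carrier_chain_group)
  fix b' assume "b' \<in> boundaries q X"
  then obtain c' where c': "c' \<in> carrier (chain_group (Suc q) X)" "b' = boundary c'"
    by (auto simp: boundaries_def)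
  show "b + b' \<in> boundaries q X"
    unfolding boundaries_def using c c' keys_add[of c c']
    by (intro image_eqI[of _ _ "c + c'"]) (auto simp: boundary_add carrier_chain_group)
qed

abbreviation homology_class :: "nat \<Rightarrow> int vec set \<Rightarrow> (int vec set \<Rightarrow>\<^sub>0 int) \<Rightarrow> (int vec set \<Rightarrow>\<^sub>0 int) set" where
  "homology_class q X c \<equiv> boundaries q X #>\<^bsub>chain_group q X\<^esub> c"

text \<open>A coset depends only on the multiplication. The elements of the quotient of the cycle
  group are therefore the cosets in the chain group that \<open>induced_map\<close> speaks
  of.\<close>

lemma r_coset_cycles:
  "boundaries q X #>\<^bsub>(chain_group q X)\<lparr>carrier := cycles q X\<rparr>\<^esub> c = homology_class q X c"
  by (simp add: r_coset_def)

lemma comm_group_cycles: "comm_group ((chain_group q X)\<lparr>carrier := cycles q X\<rparr>)"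
proof (rule group.group_comm_groupI)
  show "group ((chain_group q X)\<lparr>carrier := cycles q X\<rparr>)"
    using subgroup_cycles by (rule subgroup.subgroup_is_group) (simp add: chain_group_def)
qed (simp add: add.commute)

lemma subgroup_boundaries_cycles:
  "subgroup (boundaries q X) ((chain_group q X)\<lparr>carrier := cycles q X\<rparr>)"
  using comm_group_chain_group subgroup_boundaries subgroup_cycles boundaries_subset_cycles
  by (metis comm_group.axioms(2) group.subgroup_incl)

lemma comm_group_homology: "comm_group (homology q X)"
  unfolding homology_def
  using comm_group_cycles subgroup_boundaries_cycles by (rule comm_group.abelian_FactGroup)

lemma carrier_homology: "carrier (homology q X) = homology_class q X ` cycles q X"
  by (simp add: homology_def carrier_FactGroup r_coset_cycles)

lemma mult_homology_class:
  assumes "c \<in> cycles q X" "d \<in> cycles q X"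
  shows "homology_class q X c \<otimes>\<^bsub>homology q X\<^esub> homology_class q X d = homology_class q X (c + d)"
proof -
  interpret normal "boundaries q X" "(chain_group q X)\<lparr>carrier := cycles q X\<rparr>"
    using comm_group_cycles subgroup_boundaries_cycles by (rule comm_group.subgroup_imp_normal)
  show ?thesis
    using rcos_sum[of c d] assms by (simp add: r_coset_cycles homology_def)
qed

lemma homology_class_add_boundary:
  assumes "b \<in> boundaries q X" "c \<in> cycles q X"
  shows "homology_class q X (b + c) = homology_class q X c"
proof -
  interpret group "chain_group q X" by (simp add: chain_group_def)
  have sub: "boundaries q X \<subseteq> carrier (chain_group q X)"
    using subgroup_boundaries by (rule subgroup.subset)
  have "homology_class q X (b \<otimes>\<^bsub>chain_group q X\<^esub> c) = homology_class q X b #>\<^bsub>chain_group q X\<^esub> c"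
    using assms sub by (intro coset_mult_assoc[symmetric]) (auto simp: cycles_def)
  also have "homology_class q X b = boundaries q X"
    using assms(1) sub by (intro coset_join2 subgroup_boundaries) auto
  finally show ?thesis by simp
qed

section \<open>Induced homomorphisms on homology\<close>

lemma chain_map_cycles:
  assumes f: "c1_continuous X Y f" and Y: "Y \<subseteq> carrier_vec n" and c: "c \<in> cycles q X"
  shows "chain_map q f c \<in> cycles q Y"
proof -
  have c': "c \<in> carrier (chain_group q X)" "boundary c = 0" using c by (auto simp: cycles_def)
  have "boundary (chain_map q f c) = 0"
  proof (cases q)
    \<comment> \<open>Commutation with the boundary relates dimensions \<open>Suc q\<close> and
      \<open>q\<close>, so dimension 0 is separate: every 0-chain has zero boundary.\<close>
    case 0
    have "Poly_Mapping.keys (chain_map q f c) \<subseteq> {Q. elementary_cube 0 Q}"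
      using chain_map_closed[OF f Y c'(1)] 0 by (auto simp: carrier_chain_group)
    then show ?thesis
    proof (induction rule: frag_induction)
      case (one Q)
      then obtain x where "Q = cube x {}" by (auto elim!: elementary_cubeE)
      then show ?case by (simp add: boundary_cube)
    qed (simp_all add: boundary_diff)
  next
    case (Suc m)
    then show ?thesis using boundary_chain_map[OF f Y, of c m] c' by simp
  qed
  then show ?thesis using chain_map_closed[OF f Y c'(1)] by (simp add: cycles_def)
qed

lemma chain_map_boundaries:
  assumes f: "c1_continuous X Y f" and Y: "Y \<subseteq> carrier_vec n" and b: "b \<in> boundaries q X"
  shows "chain_map q f b \<in> boundaries q Y"
proof -
  obtain c where c: "c \<in> carrier (chain_group (Suc q) X)" "b = boundary c"
    using b by (auto simp: boundaries_def)
  then have "chain_map q f b = boundary (chain_map (Suc q) f c)"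
    using boundary_chain_map[OF f Y] by simp
  then show ?thesis using chain_map_closed[OF f Y c(1)] by (simp add: boundaries_def)
qed

text \<open>Representatives of a class differ by a boundary, which is sent to a boundary. The image
  set in the definition is thus a singleton, and \<open>the_elem\<close> reads it off.\<close>

lemma induced_map_class:
  assumes f: "c1_continuous X Y f" and Y: "Y \<subseteq> carrier_vec n" and c: "c \<in> cycles q X"
  shows "induced_map q X Y f (homology_class q X c) = homology_class q Y (chain_map q f c)"
proof -
  have "(\<lambda>c. homology_class q Y (chain_map q f c)) ` homology_class q X c =
    {homology_class q Y (chain_map q f c)}"
  proof -
    have "homology_class q Y (chain_map q f (b + c)) = homology_class q Y (chain_map q f c)"
      if "b \<in> boundaries q X" for b
      using chain_map_boundaries[OF f Y that] chain_map_cycles[OF f Y c]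
      by (simp add: chain_map_add homology_class_add_boundary)
    moreover have "homology_class q X c = (\<lambda>b. b + c) ` boundaries q X"
      by (auto simp: r_coset_def)
    \<comment> \<open>The image of an empty coset would be empty rather than a singleton.\<close>
    moreover have "boundaries q X \<noteq> {}"
      using subgroup.one_closed[OF subgroup_boundaries] by blast
    ultimately show ?thesis by (auto simp: image_image)
  qed
  then show ?thesis
    using c by (simp add: induced_map_def carrier_homology)
qed

text \<open>Extensionality settles the values off the carrier, so functor laws can be checked on
  classes of cycles.\<close>

lemma homology_map_eqI:
  assumes "f \<in> extensional (carrier (homology q X))" "g \<in> extensional (carrier (homology q X))"
    and "\<And>c. c \<in> cycles q X \<Longrightarrow> f (homology_class q X c) = g (homology_class q X c)"
  shows "f = g"
  using assms by (intro extensionalityI[of _ "carrier (homology q X)"]) (auto simp: carrier_homology)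

lemma induced_map_extensional: "induced_map q X Y f \<in> extensional (carrier (homology q X))"
  by (simp add: induced_map_def)

lemma induced_map_hom:
  assumes f: "c1_continuous X Y f" and Y: "Y \<subseteq> carrier_vec n"
  shows "induced_map q X Y f \<in> hom (homology q X) (homology q Y)"
proof (rule homI)
  fix a assume "a \<in> carrier (homology q X)"
  then obtain c where c: "c \<in> cycles q X" "a = homology_class q X c" by (auto simp: carrier_homology)
  show "induced_map q X Y f a \<in> carrier (homology q Y)"
    unfolding c(2) induced_map_class[OF f Y c(1)] carrier_homology
    using chain_map_cycles[OF f Y c(1)] by (rule imageI)
  fix b assume "b \<in> carrier (homology q X)"
  then obtain d where d: "d \<in> cycles q X" "b = homology_class q X d" by (auto simp: carrier_homology)
  have "c + d \<in> cycles q X"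
    using subgroup.m_closed[OF subgroup_cycles c(1) d(1)] by simp
  then show "induced_map q X Y f (a \<otimes>\<^bsub>homology q X\<^esub> b) =
      induced_map q X Y f a \<otimes>\<^bsub>homology q Y\<^esub> induced_map q X Y f b"
    unfolding c(2) d(2) mult_homology_class[OF c(1) d(1)]
    by (simp only: induced_map_class[OF f Y] c(1) d(1) chain_map_add
        mult_homology_class chain_map_cycles[OF f Y])
qed

section \<open>The two categories\<close>

lemma is_category_digital_image: "is_category digital_image_category"
  unfolding is_category_def
proof (intro conjI ballI)
  fix X
  show "Idt digital_image_category X \<in> Arr digital_image_category X X"
    by (simp add: digital_image_category_def c1_continuous_def)
next
  fix X Y Z f g
  assume "f \<in> Arr digital_image_category X Y" "g \<in> Arr digital_image_category Y Z"
  then have "c1_continuous X Z (g \<circ> f)"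
    by (auto simp: digital_image_category_def intro: continuous_comp)
  then show "Cmp digital_image_category X Y Z g f \<in> Arr digital_image_category X Z"
    by (simp add: digital_image_category_def c1_continuous_def compose_def Pi_def)
next
  fix X Y f assume "f \<in> Arr digital_image_category X Y"
  then have f: "f \<in> X \<rightarrow> Y" "f \<in> extensional X"
    by (auto simp: digital_image_category_def c1_continuous_def)
  show "Cmp digital_image_category X Y Y (Idt digital_image_category Y) f = f"
    using f by (simp add: digital_image_category_def Id_compose)
  show "Cmp digital_image_category X X Y f (Idt digital_image_category X) = f"
    using f by (simp add: digital_image_category_def compose_Id)
next
  fix W X Y Z f g h
  assume "f \<in> Arr digital_image_category W X"
  then have "f \<in> W \<rightarrow> X" by (simp add: digital_image_category_def c1_continuous_def)
  then show "Cmp digital_image_category W X Z (Cmp digital_image_category X Y Z h g) f =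
      Cmp digital_image_category W Y Z h (Cmp digital_image_category W X Y g f)"
    by (simp add: digital_image_category_def compose_assoc)
qed

lemma is_category_abelian_group: "is_category abelian_group_category"
  unfolding is_category_def
proof (intro conjI ballI)
  fix G :: "'a monoid"
  assume "G \<in> Ob abelian_group_category"
  then interpret comm_group G by (simp add: abelian_group_category_def)
  show "Idt abelian_group_category G \<in> Arr abelian_group_category G G"
    by (simp add: abelian_group_category_def hom_def)
next
  fix G H K :: "'a monoid" and f g
  assume "G \<in> Ob abelian_group_category" and "f \<in> Arr abelian_group_category G H"
    "g \<in> Arr abelian_group_category H K"
  then have "comm_group G" and fg: "f \<in> hom G H" "g \<in> hom H K"
    by (auto simp: abelian_group_category_def)
  interpret comm_group G by fact
  show "Cmp abelian_group_category G H K g f \<in> Arr abelian_group_category G K"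
    using hom_compose[OF fg] by (simp add: abelian_group_category_def hom_def compose_def Pi_def)
next
  fix G H :: "'a monoid" and f assume "f \<in> Arr abelian_group_category G H"
  then have f: "f \<in> carrier G \<rightarrow> carrier H" "f \<in> extensional (carrier G)"
    by (auto simp: abelian_group_category_def hom_def)
  show "Cmp abelian_group_category G H H (Idt abelian_group_category H) f = f"
    using f by (simp add: abelian_group_category_def Id_compose)
  show "Cmp abelian_group_category G G H f (Idt abelian_group_category G) = f"
    using f by (simp add: abelian_group_category_def compose_Id)
next
  fix G H K L :: "'a monoid" and f g h
  assume "f \<in> Arr abelian_group_category G H"
  then have "f \<in> carrier G \<rightarrow> carrier H" by (simp add: abelian_group_category_def hom_def)
  then show "Cmp abelian_group_category G H L (Cmp abelian_group_category H K L h g) f =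
      Cmp abelian_group_category G K L h (Cmp abelian_group_category G H K g f)"
    by (simp add: abelian_group_category_def compose_assoc)
qed

section \<open>Functoriality of homology\<close>

theorem theorem6p11:
  fixes q :: nat
  shows "is_functor digital_image_category abelian_group_category (homology q) (induced_map q)"
  unfolding is_functor_def
proof (intro conjI ballI)
  show "is_category digital_image_category" by (rule is_category_digital_image)
  show "is_category (abelian_group_category :: ((int vec set \<Rightarrow>\<^sub>0 int) set monoid, _) category)"
    by (rule is_category_abelian_group)
next
  fix X
  show "homology q X \<in> Ob abelian_group_category"
    by (simp add: abelian_group_category_def comm_group_homology)
next
  fix X Y f
  assume "Y \<in> Ob digital_image_category" "f \<in> Arr digital_image_category X Y"
  then obtain n where "Y \<subseteq> carrier_vec n" "c1_continuous X Y f"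
    by (auto simp: digital_image_category_def digital_image_def)
  then show "induced_map q X Y f \<in> Arr abelian_group_category (homology q X) (homology q Y)"
    by (simp add: abelian_group_category_def induced_map_hom induced_map_extensional)
next
  fix X assume "X \<in> Ob digital_image_category"
  then obtain n where X: "X \<subseteq> carrier_vec n"
    by (auto simp: digital_image_category_def digital_image_def)
  have "induced_map q X X (\<lambda>x\<in>X. x) = (\<lambda>a\<in>carrier (homology q X). a)"
  proof (rule homology_map_eqI)
    fix c assume c: "c \<in> cycles q X"
    have id: "c1_continuous X X (\<lambda>x\<in>X. x)" by (simp add: c1_continuous_def)
    show "induced_map q X X (\<lambda>x\<in>X. x) (homology_class q X c) =
        (\<lambda>a\<in>carrier (homology q X). a) (homology_class q X c)"
      using c induced_map_class[OF id X c] chain_map_id[of c q X]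
      by (simp add: carrier_homology cycles_def)
  qed (simp_all add: induced_map_extensional)
  then show "induced_map q X X (Idt digital_image_category X) = Idt abelian_group_category (homology q X)"
    by (simp add: digital_image_category_def abelian_group_category_def)
next
  fix X Y Z f g
  assume "Y \<in> Ob digital_image_category" "Z \<in> Ob digital_image_category"
    "f \<in> Arr digital_image_category X Y" "g \<in> Arr digital_image_category Y Z"
  then obtain m n where YZ: "Y \<subseteq> carrier_vec m" "Z \<subseteq> carrier_vec n"
    and fg: "c1_continuous X Y f" "c1_continuous Y Z g"
    by (auto simp: digital_image_category_def digital_image_def)
  have "induced_map q X Z (compose X g f) =
    compose (carrier (homology q X)) (induced_map q Y Z g) (induced_map q X Y f)"
  proof (rule homology_map_eqI)
    fix c assume c: "c \<in> cycles q X"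
    have comp: "c1_continuous X Z (compose X g f)"
      using continuous_comp[OF fg] by (simp add: c1_continuous_def compose_def Pi_def)
    have "homology_class q X c \<in> carrier (homology q X)" using c by (simp add: carrier_homology)
    moreover have "c \<in> carrier (chain_group q X)" using c by (simp add: cycles_def)
    ultimately show "induced_map q X Z (compose X g f) (homology_class q X c) =
        compose (carrier (homology q X)) (induced_map q Y Z g) (induced_map q X Y f) (homology_class q X c)"
      by (simp add: compose_eq induced_map_class[OF comp YZ(2) c] induced_map_class[OF fg(1) YZ(1) c]
          induced_map_class[OF fg(2) YZ(2) chain_map_cycles[OF fg(1) YZ(1) c]]
          chain_map_comp[OF fg YZ])
  qed (simp_all add: induced_map_extensional)
  then show "induced_map q X Z (Cmp digital_image_category X Y Z g f) =
      Cmp abelian_group_category (homology q X) (homology q Y) (homology q Z)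
        (induced_map q Y Z g) (induced_map q X Y f)"
    by (simp add: digital_image_category_def abelian_group_category_def)
qed

end
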